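(* Suppose that $f,g\in H^1(\mathbb{C}_+)$, that $|f|=|g|$ almost everywhere on $i\mathbb{R}$ (in the sense of boundary values), and that $|f|=|g|$ on $1+i\mathbb{R}$. Then $f=cg$ for some unimodular constant $c$.
   Context: $\mathbb{C}_+=\{s\in\mathbb{C}:\operatorname{Re}s>0\}$ is the right half-plane, and $H^1(\mathbb{C}_+)$ is the Hardy space of analytic functions $f$ on $\mathbb{C}_+$ with $\sup_{x>0}\int_{\mathbb{R}}|f(x+iy)|\,dy<\infty$. *)

theory Defs
  imports "HOL-Analysis.Analysis"
begin

definition right_half_plane :: "complex set" where
  "right_half_plane = {s. Re s > 0}"

definition hardy1_rhp :: "(complex \<Rightarrow> complex) set" where
  "hardy1_rhp = {f. f holomorphic_on right_half_plane \<and>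
     (SUP x\<in>{0<..}. \<integral>\<^sup>+ y. ennreal (cmod (f (Complex x y))) \<partial>lborel) < \<infinity>}"

definition has_boundary_value :: "(complex \<Rightarrow> complex) \<Rightarrow> real \<Rightarrow> complex \<Rightarrow> bool" where
  "has_boundary_value f y a \<longleftrightarrow> ((\<lambda>x. f (Complex x y)) \<longlongrightarrow> a) (at_right 0)"

end

theory Submission
  imports Defs "HOL-Complex_Analysis.Complex_Analysis" "HOL-Real_Asymp.Real_Asymp"
begin

text \<open>
  Let \<open>h = f / g\<close>. Equality of the moduli on \<open>Re s = 1\<close> gives the reflection law
  \<open>h s * cnj (h (2 - cnj s)) = 1\<close> for \<open>0 < Re s < 2\<close>. As \<open>s\<close> approaches the imaginary axis,
  \<open>2 - cnj s\<close> approaches the interior line \<open>Re s = 2\<close>, so the boundary condition becomes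
  \<open>\<bar>f\<bar> = \<bar>g\<bar>\<close> on \<open>Re s = 2\<close>, at least where the boundary values do not vanish; that this
  is a non-null set is the uniqueness theorem for \<open>H\<^sup>1\<close>. Reflecting in both lines, \<open>h\<close> has period \<open>2\<close>.

  A pole of \<open>h\<close> at \<open>a\<close> would make \<open>g\<close> vanish at all points \<open>a + 2n\<close>, which violates the
  Blaschke condition; the same holds for zeros and \<open>f\<close>. Hence \<open>h = exp k\<close>. Jensen's inequality
  for \<open>f g\<close> on hyperbolic circles bounds the means of \<open>\<bar>Re k\<bar>\<close>, whence
  \<open>\<bar>k z\<bar> = O(\<bar>z\<bar>\<^sup>2 / Re z)\<close>. Cauchy's estimate for \<open>k''\<close> at \<open>s + 2n\<close>, as \<open>n\<close> tends to infinity,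
  shows that \<open>k\<close> is affine, and then the periodicity and \<open>\<bar>h\<bar> = 1\<close> on \<open>Re s = 1\<close> make it constant.
\<close>

section \<open>Mean value inequality for the logarithm of the modulus\<close>

text \<open>On each cell of length \<open>h\<close> the sampled value of \<open>\<psi>\<close>
  exceeds the mean over the cell by at most \<open>\<epsilon>\<close>. The sample points sit at an
  arbitrary offset \<open>\<theta>\<close> in their cells, because a point of the circle has an
  arbitrary phase modulo \<open>h\<close>.\<close>

lemma riemann_sum_le_integral:
  fixes \<psi> :: "real \<Rightarrow> real"
  assumes "0 \<le> \<theta>" "\<theta> \<le> h" "continuous_on {0..real n * h} \<psi>"
    and "\<And>x y. \<lbrakk>x \<in> {0..real n * h}; y \<in> {0..real n * h}; \<bar>x - y\<bar> \<le> h\<rbrakk> \<Longrightarrow> \<psi> x \<le> \<psi> y + \<epsilon>"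
  shows "h * (\<Sum>k<n. \<psi> (\<theta> + real k * h)) \<le> integral {0..real n * h} \<psi> + real n * h * \<epsilon>"
  using assms
proof (induction n)
  case 0
  then show ?case by simp
next
  case (Suc n)
  have h0: "0 \<le> h" using Suc.prems by linarith
  have le: "real n * h \<le> real (Suc n) * h" using h0 by (intro mult_right_mono) auto
  have IH: "h * (\<Sum>k<n. \<psi> (\<theta> + real k * h)) \<le> integral {0..real n * h} \<psi> + real n * h * \<epsilon>"
  proof (rule Suc.IH[OF Suc.prems(1,2)])
    show "continuous_on {0..real n * h} \<psi>"
      using Suc.prems(3) by (rule continuous_on_subset) (use le in auto)
    show "\<psi> x \<le> \<psi> y + \<epsilon>" if "x \<in> {0..real n * h}" "y \<in> {0..real n * h}" "\<bar>x - y\<bar> \<le> h" for x y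
      using Suc.prems(4)[of x y] that le by auto
  qed
  have int: "\<psi> integrable_on {0..real (Suc n) * h}"
    by (rule integrable_continuous_interval[OF Suc.prems(3)])
  have split: "integral {0..real (Suc n) * h} \<psi> =
      integral {0..real n * h} \<psi> + integral {real n * h..real (Suc n) * h} \<psi>"
    using int le h0 by (subst Henstock_Kurzweil_Integration.integral_combine) auto
  have "(\<psi> (\<theta> + real n * h) - \<epsilon>) * h =
      integral {real n * h..real (Suc n) * h} (\<lambda>_. \<psi> (\<theta> + real n * h) - \<epsilon>)"
    using le by (simp add: algebra_simps)
  also have "\<dots> \<le> integral {real n * h..real (Suc n) * h} \<psi>"
  proof (rule integral_le)
    show "\<psi> integrable_on {real n * h..real (Suc n) * h}"
      by (rule integrable_subinterval_real[OF int]) (use h0 in auto)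
    show "\<psi> (\<theta> + real n * h) - \<epsilon> \<le> \<psi> x" if "x \<in> {real n * h..real (Suc n) * h}" for x
    proof -
      have nh: "0 \<le> real n * h" using h0 by simp
      have "0 \<le> x" using nh that by auto
      with nh have "\<psi> (\<theta> + real n * h) \<le> \<psi> x + \<epsilon>"
        using that Suc.prems(1,2) by (intro Suc.prems(4)) (auto simp: algebra_simps)
      then show ?thesis by simp
    qed
  qed auto
  finally show ?case
    using IH split by (simp add: algebra_simps)
qed

text \<open>Apply the maximum principle to the product of the rotations of \<open>F\<close> by \<open>n\<close>-th roots of
  unity: its modulus at the centre is \<open>\<bar>F 0\<bar> ^ n\<close>, on the circle it is controlled by a Riemann
  sum of \<open>\<psi>\<close>.\<close>

lemma norm_center_le_exp_mean:
  fixes F :: "complex \<Rightarrow> complex" and \<psi> :: "complex \<Rightarrow> real"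
  assumes r: "r > 0" and holo: "F holomorphic_on ball 0 r" and cont: "continuous_on (cball 0 r) F"
    and cpsi: "continuous_on (sphere 0 r) \<psi>"
    and bound: "\<And>w. w \<in> sphere 0 r \<Longrightarrow> norm (F w) \<le> exp (\<psi> w)"
  shows "norm (F 0) \<le> exp (integral {0..2*pi} (\<lambda>t. \<psi> (r * cis t)) / (2*pi))"
proof -
  define p where "p = (\<lambda>t. \<psi> (complex_of_real r * cis t))"
  have cp: "continuous_on A p" for A
    unfolding p_def using r
    by (intro continuous_on_compose2[OF cpsi] continuous_intros) (auto simp: norm_mult)
  have main: "ln (norm (F 0)) \<le> integral {0..2*pi} p / (2*pi) + \<epsilon>"
    if F0: "F 0 \<noteq> 0" and e: "\<epsilon> > 0" for \<epsilon>
  proof -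
    have "uniformly_continuous_on {0..2*pi} p"
      by (intro compact_uniformly_continuous cp) auto
    then obtain d where d: "d > 0"
      and ud: "\<And>x y. \<lbrakk>x \<in> {0..2*pi}; y \<in> {0..2*pi}; dist y x < d\<rbrakk> \<Longrightarrow> dist (p y) (p x) < \<epsilon>"
      unfolding uniformly_continuous_on_def using e by metis
    \<comment> \<open>So many roots of unity that the mesh \<open>2*pi/n\<close> is finer than the
      modulus of continuity \<open>d\<close> of \<open>p\<close>.\<close>
    obtain n :: nat where n: "2*pi/d < real n" using reals_Archimedean2 by blast
    have n0: "n > 0" using n d by (metis divide_pos_pos gr0I less_asym of_nat_0 pi_gt_zero zero_less_mult_iff zero_less_numeral)
    define h where "h = 2*pi/real n"
    have h: "h > 0" "h < d" "real n * h = 2*pi"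
      using n n0 d by (auto simp: h_def field_simps)
    define G where "G = (\<lambda>w. \<Prod>k<n. F (w * cis (real k * h)))"
    have G0: "norm (G 0) = norm (F 0) ^ n" by (simp add: G_def norm_power)
    \<comment> \<open>Rotation by \<open>h\<close> permutes the factors cyclically: the last one
      wraps around because \<open>n * h = 2*pi\<close>.\<close>
    have rot: "G (w * cis h) = G w" for w
    proof -
      obtain m where m: "n = Suc m" using n0 by (cases n) auto
      have "G (w * cis h) = (\<Prod>k<n. F (w * cis (real (Suc k) * h)))"
        unfolding G_def by (intro prod.cong refl) (simp add: cis_mult mult.assoc algebra_simps)
      also have "\<dots> = (\<Prod>k<m. F (w * cis (real (Suc k) * h))) * F (w * cis (real n * h))"
        by (simp add: m)
      also have "F (w * cis (real n * h)) = F w" by (simp add: h(3))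
      also have "(\<Prod>k<m. F (w * cis (real (Suc k) * h))) * F w = G w"
        unfolding G_def m by (subst prod.lessThan_Suc_shift) simp
      finally show ?thesis .
    qed
    have rots: "G (w * cis (real j * h)) = G w" for w j
    proof (induction j)
      case (Suc j)
      have "w * cis (real (Suc j) * h) = (w * cis (real j * h)) * cis h"
        by (simp add: cis_mult algebra_simps)
      then show ?case using Suc rot by metis
    qed simp
    have Gb: "norm (G w) \<le> exp (n * (integral {0..2*pi} p / (2*pi) + \<epsilon>))"
      if w: "w \<in> sphere 0 r" for w
    proof -
      obtain \<phi> where phi: "0 \<le> \<phi>" "\<phi> < 2*pi" "w = of_real r * cis \<phi>"
        using w Arg2pi[of w] by (auto simp: cis_conv_exp is_Arg_def)
      \<comment> \<open>Whole steps of length \<open>h\<close> are rotated away, and the remainder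
        \<open>\<theta>\<close> becomes the offset of the Riemann sum.\<close>
      define j where "j = nat \<lfloor>\<phi> / h\<rfloor>"
      define \<theta> where "\<theta> = \<phi> - real j * h"
      have j: "real j \<le> \<phi>/h" "\<phi>/h < real j + 1"
        using phi(1) h(1) unfolding j_def by (auto simp: of_nat_nat)
      have th: "0 \<le> \<theta>" "\<theta> \<le> h"
        using j h(1) by (auto simp: \<theta>_def field_simps)
      have "w = (of_real r * cis \<theta>) * cis (real j * h)"
        unfolding phi(3) \<theta>_def by (simp add: cis_mult mult.assoc)
      then have "norm (G w) = norm (G (of_real r * cis \<theta>))" using rots by simp
      also have "\<dots> = (\<Prod>k<n. norm (F (of_real r * cis (\<theta> + real k * h))))"
        unfolding G_def prod_norm[symmetric] by (simp add: mult.assoc cis_mult)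
      also have "\<dots> \<le> (\<Prod>k<n. exp (p (\<theta> + real k * h)))"
        unfolding p_def using r by (intro prod_mono conjI bound) (auto simp: norm_mult)
      also have "\<dots> = exp (\<Sum>k<n. p (\<theta> + real k * h))" by (simp add: exp_sum)
      also have "(\<Sum>k<n. p (\<theta> + real k * h)) \<le> n * (integral {0..2*pi} p / (2*pi) + \<epsilon>)"
      proof -
        have "h * (\<Sum>k<n. p (\<theta> + real k * h)) \<le> integral {0..real n * h} p + real n * h * \<epsilon>"
        proof (rule riemann_sum_le_integral[OF th cp])
          show "p x \<le> p y + \<epsilon>" if "x \<in> {0..real n * h}" "y \<in> {0..real n * h}" "\<bar>x - y\<bar> \<le> h" for x y
          proof -
            have "\<bar>p y - p x\<bar> < \<epsilon>"
              using ud[of x y] that h by (auto simp: dist_real_def abs_minus_commute)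
            then show ?thesis by linarith
          qed
        qed
        then have "(\<Sum>k<n. p (\<theta> + real k * h)) \<le> (integral {0..2*pi} p + 2*pi * \<epsilon>) / h"
          using h by (simp add: field_simps)
        also have "\<dots> = n * (integral {0..2*pi} p / (2*pi) + \<epsilon>)"
          using n0 by (simp add: h_def field_simps)
        finally show ?thesis .
      qed
      finally show ?thesis by simp
    qed
    have "norm (G 0) \<le> exp (n * (integral {0..2*pi} p / (2*pi) + \<epsilon>))"
    proof (rule maximum_modulus_frontier[of G "cball 0 r"])
      show "G holomorphic_on interior (cball 0 r)"
        unfolding G_def interior_cball
        by (intro holomorphic_intros holomorphic_on_compose_gen[OF _ holo, unfolded o_def])
           (auto simp: norm_mult)
      show "continuous_on (closure (cball 0 r)) G"
        unfolding G_def closure_closed[OF closed_cball]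
        by (intro continuous_intros continuous_on_compose2[OF cont]) (auto simp: norm_mult)
      show "norm (G z) \<le> exp (n * (integral {0..2*pi} p / (2*pi) + \<epsilon>))" if "z \<in> frontier (cball 0 r)" for z
        using Gb[of z] that by (auto simp: frontier_cball)
    qed (use r in auto)
    \<comment> \<open>Both sides carry the exponent \<open>n\<close>; cancelling it leaves a bound
      free of \<open>n\<close>.\<close>
    then have "exp (n * ln (norm (F 0))) \<le> exp (n * (integral {0..2*pi} p / (2*pi) + \<epsilon>))"
      using F0 by (simp add: G0 exp_of_nat_mult)
    then show ?thesis using n0 by simp
  qed
  show ?thesis
  proof (cases "F 0 = 0")
    case False
    then have "ln (norm (F 0)) \<le> integral {0..2*pi} p / (2*pi)"
      using main by (meson field_le_epsilon)
    then have "exp (ln (norm (F 0))) \<le> exp (integral {0..2*pi} p / (2*pi))" by simp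
    then show ?thesis using False by (simp add: p_def)
  qed auto
qed

section \<open>Functions of Hardy class on the right half-plane\<close>

lemma right_half_plane_open [simp]: "open right_half_plane"
  unfolding right_half_plane_def by (rule open_halfspace_Re_gt)

lemma right_half_plane_convex: "convex right_half_plane"
  unfolding right_half_plane_def by (rule convex_halfspace_Re_gt)

lemma right_half_plane_connected: "connected right_half_plane"
  by (intro convex_connected right_half_plane_convex)

lemma mem_right_half_plane [simp]: "z \<in> right_half_plane \<longleftrightarrow> Re z > 0"
  by (simp add: right_half_plane_def)

lemma continuous_on_vertical_line:
  assumes "f holomorphic_on right_half_plane" "x > 0" "continuous_on A u"
  shows "continuous_on A (\<lambda>t. f (Complex x (u t)))"
proof (rule continuous_on_compose2[OF holomorphic_on_imp_continuous_on[OF assms(1)]])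
  show "continuous_on A (\<lambda>t. Complex x (u t))"
    unfolding Complex_eq by (intro continuous_intros assms(3))
qed (use assms(2) in auto)

section \<open>Consequences of the finite H^1 norm\<close>

lemma hardy1_nn_integral_le:
  assumes "f \<in> hardy1_rhp"
  obtains C where "C \<ge> 0" "\<And>x. x > 0 \<Longrightarrow> (\<integral>\<^sup>+ y. ennreal (cmod (f (Complex x y))) \<partial>lborel) \<le> ennreal C"
proof -
  let ?S = "SUP x\<in>{0<..}. \<integral>\<^sup>+ y. ennreal (cmod (f (Complex x y))) \<partial>lborel"
  have "?S < \<infinity>" using assms by (simp add: hardy1_rhp_def)
  then obtain C where C: "C \<ge> 0" "?S = ennreal C"
    by (cases ?S) auto
  have "(\<integral>\<^sup>+ y. ennreal (cmod (f (Complex x y))) \<partial>lborel) \<le> ?S" if "x > 0" for x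
    using that by (intro SUP_upper) auto
  then show ?thesis using that C by auto
qed

lemma hardy1_holomorphic: "f \<in> hardy1_rhp \<Longrightarrow> f holomorphic_on right_half_plane"
  by (simp add: hardy1_rhp_def)

text \<open>Links the Lebesgue bound on a whole vertical line to the gauge integrals over segments
  that arise from primitives; the shift by \<open>y\<close> is absorbed by translation
  invariance.\<close>

lemma vertical_integral_le:
  assumes hol: "f holomorphic_on right_half_plane" and x: "x > 0" and "C \<ge> 0"
    and C: "(\<integral>\<^sup>+ y. ennreal (cmod (f (Complex x y))) \<partial>lborel) \<le> ennreal C"
  shows "integral {0..b} (\<lambda>t. cmod (f (Complex x (y + t)))) \<le> C"
proof -
  let ?g = "\<lambda>t. cmod (f (Complex x (y + t)))"
  have cont: "continuous_on A ?g" for A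
    by (intro continuous_intros continuous_on_vertical_line[OF hol x])
  then have meas: "?g \<in> borel_measurable borel"
    by (intro borel_measurable_continuous_onI)
  have "(?g has_integral integral {0..b} ?g) {0..b}"
    by (intro integrable_integral integrable_continuous_interval cont)
  then have "((\<lambda>t. if t \<in> {0..b} then ?g t else 0) has_integral integral {0..b} ?g) UNIV"
    by (simp only: has_integral_restrict_UNIV)
  then have "ennreal (integral {0..b} ?g) = (\<integral>\<^sup>+ t. (if t \<in> {0..b} then ?g t else 0) \<partial>lborel)"
    by (intro nn_integral_has_integral_lborel[symmetric] measurable_If meas) auto
  also have "\<dots> \<le> (\<integral>\<^sup>+ t. ennreal (?g t) \<partial>lborel)"
    by (intro nn_integral_mono) auto
  also have "\<dots> = (\<integral>\<^sup>+ t. ennreal (cmod (f (Complex x t))) \<partial>lborel)"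
    using nn_integral_real_affine[of "\<lambda>t. ennreal (cmod (f (Complex x t)))" 1 y]
      borel_measurable_continuous_onI[OF continuous_on_norm[OF continuous_on_vertical_line[OF hol x continuous_on_id]]]
    by simp
  also have "\<dots> \<le> ennreal C" by (rule C)
  finally show ?thesis using \<open>C \<ge> 0\<close> by simp
qed

text \<open>For a primitive \<open>P\<close> of \<open>f\<close>, the difference \<open>P (z + i\<eta>) - P z\<close> is bounded by the \<open>H\<^sup>1\<close>-norm,
  so Cauchy's estimate bounds its derivative \<open>f (z + i\<eta>) - f z\<close> uniformly in \<open>\<eta>\<close>; and
  \<open>f (z + i\<eta>)\<close> is small for some \<open>\<eta>\<close> by integrability.\<close>

lemma hardy1_bounded:
  assumes f: "f \<in> hardy1_rhp" and d: "d > 0"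
  obtains M where "M > 0" "\<And>z. Re z \<ge> d \<Longrightarrow> cmod (f z) \<le> M"
proof -
  note hol = hardy1_holomorphic[OF f]
  obtain C where C0: "C \<ge> 0" and
    C: "\<And>x. x > 0 \<Longrightarrow> (\<integral>\<^sup>+ y. ennreal (cmod (f (Complex x y))) \<partial>lborel) \<le> ennreal C"
    using hardy1_nn_integral_le[OF f] by blast
  obtain P where P': "\<And>z. z \<in> right_half_plane \<Longrightarrow> (P has_field_derivative f z) (at z within right_half_plane)"
    using holomorphic_convex_primitive'[OF right_half_plane_convex right_half_plane_open hol] by blast
  have P: "(P has_field_derivative f z) (at z)" if "Re z > 0" for z
    using P'[of z] that by (simp add: at_within_open[of z right_half_plane])
  have diff: "cmod (P (z + \<i> * of_real \<eta>) - P z) \<le> C" if z: "Re z > 0" and eta: "\<eta> \<ge> 0" for z \<eta>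
  proof -
    let ?g = "\<lambda>t. f (Complex (Re z) (Im z + t))"
    have zt: "z + \<i> * of_real t = Complex (Re z) (Im z + t)" for t
      by (simp add: complex_eq_iff)
    have "((\<lambda>t. \<i> * ?g t) has_integral (P (z + \<i> * of_real \<eta>) - P (z + \<i> * of_real 0))) {0..\<eta>}"
    proof (rule fundamental_theorem_of_calculus[OF eta])
      fix t assume "t \<in> {0..\<eta>}"
      have "((\<lambda>t. z + \<i> * of_real t) has_vector_derivative \<i>) (at t)"
        by (auto intro!: derivative_eq_intros)
      from field_vector_diff_chain_at[OF this P, unfolded o_def]
      have "((\<lambda>t. P (z + \<i> * of_real t)) has_vector_derivative (\<i> * f (z + \<i> * of_real t))) (at t)"
        using z by simp
      then show "((\<lambda>t. P (z + \<i> * of_real t)) has_vector_derivative (\<i> * ?g t)) (at t within {0..\<eta>})"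
        unfolding zt by (rule has_vector_derivative_at_within)
    qed
    then have "P (z + \<i> * of_real \<eta>) - P z = integral {0..\<eta>} (\<lambda>t. \<i> * ?g t)"
      by (metis integral_unique add.right_neutral mult_zero_right of_real_0)
    also have "cmod \<dots> \<le> integral {0..\<eta>} (\<lambda>t. cmod (?g t))"
      using z by (intro integral_norm_bound_integral integrable_continuous_interval continuous_intros
          continuous_on_vertical_line[OF hol]) (auto simp: norm_mult)
    also have "\<dots> \<le> C"
      by (rule vertical_integral_le[OF hol z C0 C[OF z]])
    finally show ?thesis .
  qed
  \<comment> \<open>Otherwise the modulus exceeds 1 on a whole upward ray, and its integral over a
    segment of length \<open>C + 1\<close> is larger than \<open>C\<close>.\<close>
  have small: "\<exists>\<eta>\<ge>0. cmod (f (z + \<i> * of_real \<eta>)) \<le> 1" if z: "Re z > 0" for z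
  proof (rule ccontr)
    assume *: "\<not> ?thesis"
    have zt: "z + \<i> * of_real t = Complex (Re z) (Im z + t)" for t
      by (simp add: complex_eq_iff)
    let ?g = "\<lambda>t. cmod (f (Complex (Re z) (Im z + t)))"
    have "C + 1 = integral {0..C+1} (\<lambda>_. 1)" using C0 by simp
    also have "\<dots> \<le> integral {0..C+1} ?g"
      using * z unfolding zt
      by (intro integral_le integrable_continuous_interval continuous_intros continuous_on_vertical_line[OF hol]) force+
    also have "\<dots> \<le> C"
      by (rule vertical_integral_le[OF hol z C0 C[OF z]])
    finally show False by simp
  qed
  have "cmod (f z) \<le> 1 + 2 * C / d" if z: "Re z \<ge> d" for z
  proof -
    have z0: "Re z > 0" using z d by simp
    obtain \<eta> where eta: "\<eta> \<ge> 0" "cmod (f (z + \<i> * of_real \<eta>)) \<le> 1" using small[OF z0] by blast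
    define D where "D = (\<lambda>z. P (z + \<i> * of_real \<eta>) - P z)"
    have D: "(D has_field_derivative (f (z + \<i> * of_real \<eta>) - f z)) (at z)" if "Re z > 0" for z
    proof -
      have "((\<lambda>z. P (z + \<i> * of_real \<eta>)) has_field_derivative f (z + \<i> * of_real \<eta>)) (at z)"
        using P[of "z + \<i> * of_real \<eta>"] that by (simp add: DERIV_shift)
      then show ?thesis unfolding D_def by (intro DERIV_diff P that)
    qed
    have sub: "Re w > 0" if "w \<in> cball z (d/2)" for w
    proof -
      have "\<bar>Re (z - w)\<bar> \<le> d/2" using that abs_Re_le_cmod[of "z - w"] by (auto simp: dist_norm)
      then have "Re z - Re w \<le> d/2" unfolding abs_le_iff by simp
      then show ?thesis using z d by linarith
    qed
    have holD: "D holomorphic_on cball z (d/2)"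
      using D sub by (meson field_differentiable_def field_differentiable_at_within holomorphic_on_def)
    \<comment> \<open>The radius \<open>d/2\<close> keeps the disc inside the half-plane, where
      \<open>D\<close> is bounded by \<open>C\<close>.\<close>
    have "norm ((deriv ^^ 1) D z) \<le> fact 1 * C / (d/2)^1"
    proof (rule Cauchy_inequality)
      show "D holomorphic_on ball z (d/2)" using holD holomorphic_on_subset ball_subset_cball by blast
      show "norm (D x) \<le> C" if "norm (z - x) = d/2" for x
        unfolding D_def using sub[of x] that by (intro diff eta) (auto simp: dist_norm)
    qed (use d holD holomorphic_on_imp_continuous_on in auto)
    then have "cmod (f (z + \<i> * of_real \<eta>) - f z) \<le> 2 * C / d"
      using DERIV_imp_deriv[OF D[OF z0]] by (simp add: mult.commute)
    then show ?thesis
      using eta(2) norm_triangle_ineq4[of "f (z + \<i> * of_real \<eta>)" "f (z + \<i> * of_real \<eta>) - f z"] by simp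
  qed
  moreover have "1 + 2 * C / d > 0" using C0 d by (simp add: add_pos_nonneg)
  ultimately show ?thesis using that by blast
qed

section \<open>Reflection in vertical lines\<close>

text \<open>If all bounded parts were finite, \<open>S\<close> would be a countable union of finite
  sets.\<close>

lemma uncountable_imp_infinite_bounded_part:
  fixes S :: "real set"
  assumes "uncountable S"
  obtains b where "infinite (S \<inter> {-b..b})"
proof -
  have "\<exists>n. infinite (S \<inter> {-real n..real n})"
  proof (rule ccontr)
    assume "\<not> ?thesis"
    then have "countable (\<Union>n. S \<inter> {-real n..real n})"
      by (intro countable_UN) (auto intro: countable_finite)
    moreover have "S \<subseteq> (\<Union>n. S \<inter> {-real n..real n})"
    proof
      fix x assume "x \<in> S"
      obtain n where "\<bar>x\<bar> \<le> real n" using real_arch_simple by blast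
      then have "x \<in> S \<inter> {-real n..real n}" using \<open>x \<in> S\<close> by auto
      then show "x \<in> (\<Union>n. S \<inter> {-real n..real n})" by blast
    qed
    ultimately show False using assms countable_subset by blast
  qed
  then show ?thesis using that by blast
qed

text \<open>Bolzano-Weierstrass on an infinite bounded part; the limit point stays on the line
  because the line is closed. This feeds the identity theorem.\<close>

lemma uncountable_vertical_islimpt:
  assumes "uncountable S"
  obtains \<xi> where "Re \<xi> = c" "\<xi> islimpt (Complex c ` S)"
proof -
  obtain b where inf: "infinite (S \<inter> {-b..b})"
    using uncountable_imp_infinite_bounded_part[OF assms] .
  let ?U = "Complex c ` (S \<inter> {-b..b})"
  have "infinite ?U" using inf by (subst finite_image_iff) (auto simp: inj_on_def)
  moreover have "bounded ?U"
  proof (rule boundedI)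
    show "norm z \<le> \<bar>c\<bar> + b" if "z \<in> ?U" for z
      using that cmod_le[of z] by auto
  qed
  ultimately obtain \<xi> where xi: "\<xi> islimpt ?U" using bounded_infinite_imp_islimpt by blast
  have "closed {z. Re z = c}"
    by (intro closed_Collect_eq continuous_intros)
  moreover have "\<xi> islimpt {z. Re z = c}" by (rule islimpt_subset[OF xi]) auto
  ultimately have "Re \<xi> = c" using closed_limpt by auto
  moreover have "\<xi> islimpt (Complex c ` S)" by (rule islimpt_subset[OF xi]) auto
  ultimately show ?thesis using that by blast
qed

text \<open>The identity theorem, phrased with uncountable sets so that countable exceptional sets
  can be removed from a line.\<close>

lemma uncountable_vertical_zeros_imp_zero:
  assumes f: "f holomorphic_on right_half_plane" and c: "c > 0"
    and S: "uncountable S" "\<And>y. y \<in> S \<Longrightarrow> f (Complex c y) = 0" and z: "Re z > 0"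
  shows "f z = 0"
proof -
  obtain \<xi> where xi: "Re \<xi> = c" "\<xi> islimpt (Complex c ` S)"
    using uncountable_vertical_islimpt[OF S(1)] .
  show ?thesis
  proof (rule analytic_continuation[OF f right_half_plane_open right_half_plane_connected _ _ xi(2)])
    show "f w = 0" if w: "w \<in> Complex c ` S" for w
      using w S(2) by auto
  qed (use z xi c in auto)
qed

text \<open>The map \<open>s \<mapsto> 2 * c - cnj s\<close> is the reflection in the line
  \<open>Re s = c\<close>; the outer conjugation undoes its antiholomorphy.\<close>

lemma holomorphic_reflected:
  fixes c :: real
  assumes "f holomorphic_on right_half_plane"
  shows "(\<lambda>s. cnj (f (2 * c - cnj s))) holomorphic_on {s. 0 < Re s \<and> Re s < 2 * c}"
proof -
  let ?A = "{s. 0 < Re s \<and> Re s < 2 * c}"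
  have op: "open ?A"
    by (intro open_Collect_conj open_Collect_less continuous_intros)
  have "(f \<circ> (\<lambda>w. 2 * c - w)) holomorphic_on cnj ` ?A"
    by (intro holomorphic_on_compose_gen[OF _ assms] holomorphic_intros) auto
  from holomorphic_on_compose_cnj_cnj[OF this op] show ?thesis by (simp add: o_def)
qed

text \<open>The reflection fixes the line \<open>Re s = c\<close>, where the two sides are the
  squared moduli; the identity theorem carries the equality to the strip. The product form avoids
  dividing at zeros of \<open>g\<close>.\<close>

lemma reflection_identity:
  fixes c :: real
  assumes f: "f holomorphic_on right_half_plane" and g: "g holomorphic_on right_half_plane"
    and c: "c > 0" and S: "uncountable S"
    and eq: "\<And>y. y \<in> S \<Longrightarrow> cmod (f (Complex c y)) = cmod (g (Complex c y))"
    and s: "0 < Re s" "Re s < 2 * c"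
  shows "f s * cnj (f (2 * c - cnj s)) = g s * cnj (g (2 * c - cnj s))"
proof -
  let ?A = "{s. 0 < Re s \<and> Re s < 2 * c}"
  have op: "open ?A"
    by (intro open_Collect_conj open_Collect_less continuous_intros)
  have A: "?A = {s. Re s > 0} \<inter> {s. Re s < 2 * c}" by auto
  have "convex ?A" unfolding A by (intro convex_Int convex_halfspace_Re_gt convex_halfspace_Re_lt)
  then have conn: "connected ?A" by (rule convex_connected)
  have sub: "?A \<subseteq> right_half_plane" by auto
  obtain \<xi> where xi: "Re \<xi> = c" "\<xi> islimpt (Complex c ` S)"
    using uncountable_vertical_islimpt[OF S] .
  let ?F = "\<lambda>s. f s * cnj (f (2 * c - cnj s)) - g s * cnj (g (2 * c - cnj s))"
  have "?F s = 0"
  proof (rule analytic_continuation[of ?F ?A "Complex c ` S" \<xi>])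
    show "?F holomorphic_on ?A"
      by (intro holomorphic_intros holomorphic_reflected f g holomorphic_on_subset[OF _ sub])
    show "?F z = 0"
      if z: "z \<in> Complex c ` S" for z
    proof -
      obtain y where y: "y \<in> S" "z = Complex c y" using z by auto
      have "2 * of_real c - cnj z = z" using y by (simp add: complex_eq_iff)
      then show ?thesis using eq[OF y(1)] y(2) by (simp add: complex_norm_square[symmetric])
    qed
  qed (use op conn xi c s in auto)
  then show ?thesis by simp
qed

section \<open>Zeros in arithmetic progression\<close>

lemma Re_cayley_pos:
  assumes "norm w < 1"
  shows "Re ((1 + w) / (1 - w)) > 0"
proof -
  have ne: "1 - w \<noteq> 0" using assms by auto
  have sq: "(Re w)\<^sup>2 + (Im w)\<^sup>2 < 1"
    using assms by (simp add: cmod_def)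
  have "Re ((1 + w) / (1 - w)) = (1 - ((Re w)\<^sup>2 + (Im w)\<^sup>2)) / (cmod (1 - w))\<^sup>2"
    unfolding cmod_power2 Re_divide by (simp add: power2_eq_square algebra_simps)
  then show ?thesis using sq ne by simp
qed

text \<open>A point of the right half-plane is closer to \<open>p\<close> than to the mirror image
  \<open>-p\<close>.\<close>

lemma norm_cayley_inverse_less_1:
  fixes p :: real
  assumes "Re z > 0" "p > 0"
  shows "norm ((z - p) / (z + p)) < 1"
proof -
  have "(cmod (z - p))\<^sup>2 < (cmod (z + p))\<^sup>2"
    unfolding cmod_power2 using assms by (simp add: power2_eq_square algebra_simps)
  then have "cmod (z - p) < cmod (z + p)" by (rule power_less_imp_less_base) simp
  then show ?thesis using assms by (auto simp: norm_divide divide_less_eq_1)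
qed

text \<open>Schwarz's lemma on the disc, transported by the Cayley map \<open>\<phi>\<close> that
  sends 0 to \<open>p\<close>.\<close>

lemma half_plane_schwarz:
  fixes p :: real
  assumes G: "G holomorphic_on right_half_plane"
    and M: "\<And>z. z \<in> right_half_plane \<Longrightarrow> cmod (G z) \<le> M"
    and p: "p > 0" "G p = 0" and z: "Re z > 0"
  shows "cmod (G z) \<le> M * cmod ((z - p) / (z + p))"
proof -
  have "cmod (G z) \<le> M" using M z by simp
  then have M0: "M \<ge> 0" using norm_ge_zero[of "G z"] by linarith
  have ne: "z + p \<noteq> 0" using z p by (auto simp: complex_eq_iff)
  define w where "w = (z - p) / (z + p)"
  have w: "norm w < 1" unfolding w_def by (rule norm_cayley_inverse_less_1[OF z p(1)])
  define \<phi> where "\<phi> = (\<lambda>w::complex. p * ((1 + w) / (1 - w)))"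
  have phi_pos: "Re (\<phi> w) > 0" if "norm w < 1" for w
  proof -
    have "Re (\<phi> w) = p * Re ((1 + w) / (1 - w))"
      unfolding \<phi>_def by (simp only: times_complex.simps Re_complex_of_real Im_complex_of_real mult_zero_left diff_zero)
    then show ?thesis using Re_cayley_pos[OF that] p by (simp only: mult_pos_pos)
  qed
  have phiw: "\<phi> w = z"
  proof -
    have "1 + w = 2 * z / (z + p)" "1 - w = 2 * p / (z + p)"
      using ne by (auto simp: w_def field_simps)
    then show ?thesis using ne p by (simp add: \<phi>_def)
  qed
  \<comment> \<open>Schwarz's lemma asks for values strictly inside the unit disc, hence the
    division by \<open>M + e\<close> instead of \<open>M\<close>; afterwards \<open>e\<close> tends
    to 0.\<close>
  have key: "cmod (G z) \<le> (M + e) * norm w" if e: "e > 0" for e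
  proof -
    have Me: "M + e > 0" using M0 e by simp
    have "norm ((\<lambda>w. G (\<phi> w) / (M + e)) w) \<le> norm w"
    proof (rule Schwarz_Lemma(1))
      have "(G \<circ> \<phi>) holomorphic_on ball 0 1"
        unfolding \<phi>_def
        by (intro holomorphic_on_compose_gen[OF _ G] holomorphic_intros) (use phi_pos in \<open>auto simp: \<phi>_def\<close>)
      then show "(\<lambda>w. G (\<phi> w) / (M + e)) holomorphic_on ball 0 1"
        using Me by (intro holomorphic_intros) (auto simp: o_def simp flip: of_real_add)
      show "G (\<phi> 0) / (M + e) = 0" using p by (simp add: \<phi>_def)
      show "norm (G (\<phi> w) / (M + e)) < 1" if "norm w < 1" for w
      proof -
        have "norm (G (\<phi> w)) < M + e" using M[of "\<phi> w"] phi_pos[OF that] e by simp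
        then show ?thesis using Me by (simp add: norm_divide flip: of_real_add)
      qed
    qed (rule w)
    then show ?thesis using Me by (simp add: phiw norm_divide field_simps flip: of_real_add)
  qed
  have *: "cmod (G z) \<le> M * norm w + e * norm w" if "e > 0" for e
    using key[OF that] by (simp add: distrib_right)
  have "cmod (G z) \<le> M * norm w"
  proof (rule field_le_epsilon)
    fix e :: real assume "e > 0"
    then show "cmod (G z) \<le> M * norm w + e"
      using *[of e] w mult_left_le[of "norm w" e] by linarith
  qed
  then show ?thesis by (simp add: w_def)
qed

text \<open>Dividing out a Blaschke factor does not raise the bound: away from \<open>p\<close> this
  is the Schwarz estimate, and at \<open>p\<close> it follows by continuity.\<close>

lemma half_plane_divide_zero:
  fixes p :: real
  assumes G: "G holomorphic_on right_half_plane"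
    and M: "\<And>z. z \<in> right_half_plane \<Longrightarrow> cmod (G z) \<le> M"
    and p: "p > 0" "G p = 0"
  obtains H where "H holomorphic_on right_half_plane"
    "\<And>z. z \<in> right_half_plane \<Longrightarrow> cmod (H z) \<le> M"
    "\<And>z. z \<in> right_half_plane \<Longrightarrow> G z = (z - p) / (z + p) * H z"
proof -
  define H where "H = (\<lambda>z::complex. (z + p) * (if z = p then deriv G p else (G z - G p) / (z - p)))"
  have holo: "H holomorphic_on right_half_plane"
    unfolding H_def by (intro holomorphic_intros pole_lemma_open[OF G]) simp
  have eq: "G z = (z - p) / (z + p) * H z" if "z \<in> right_half_plane" for z
  proof -
    have "z + p \<noteq> 0" using that p by (auto simp: complex_eq_iff)
    then show ?thesis using p by (auto simp: H_def)
  qed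
  have off: "cmod (H z) \<le> M" if "z \<in> right_half_plane" "z \<noteq> p" for z
  proof -
    have ne: "z + p \<noteq> 0" using that p by (auto simp: complex_eq_iff)
    have "cmod ((z - p) / (z + p)) * cmod (H z) \<le> M * cmod ((z - p) / (z + p))"
      using half_plane_schwarz[OF G M p, of z] that unfolding eq[OF that(1)] norm_mult by simp
    moreover have "cmod ((z - p) / (z + p)) > 0" using ne that by simp
    ultimately show ?thesis by (simp only: mult.commute[of M] mult_le_cancel_left_pos)
  qed
  have "cmod (H p) \<le> M"
  proof (rule tendsto_upperbound)
    have "isCont H p"
      using holomorphic_on_imp_continuous_on[OF holo] p by (auto simp: continuous_on_eq_continuous_at)
    then show "((\<lambda>z. cmod (H z)) \<longlongrightarrow> cmod (H p)) (at (of_real p))"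
      by (intro tendsto_norm) (simp add: isCont_def)
    have "\<forall>\<^sub>F z in at (complex_of_real p). z \<in> right_half_plane"
      using p by (intro eventually_at_in_open') auto
    then show "\<forall>\<^sub>F z in at (complex_of_real p). cmod (H z) \<le> M"
      using eventually_neq_at_within[of "complex_of_real p"] by eventually_elim (rule off)
  qed simp
  then show ?thesis using that[of H] holo off eq by metis
qed

text \<open>The Blaschke product of the zeros \<open>\<alpha> + 2n\<close> telescopes at the point \<open>1\<close>.\<close>

lemma half_plane_progression_zeros_bound:
  fixes \<alpha> :: real
  assumes "G holomorphic_on right_half_plane"
    and "\<And>z. z \<in> right_half_plane \<Longrightarrow> cmod (G z) \<le> M"
    and "\<alpha> > 1" and "\<And>n::nat. G (of_real (\<alpha> + 2 * real n)) = 0"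
  shows "cmod (G 1) \<le> M * (\<alpha> - 1) / (\<alpha> + 2 * real N - 1)"
  using assms
proof (induction N arbitrary: G \<alpha>)
  case 0
  then show ?case by simp
next
  case (Suc N)
  have a0: "\<alpha> > 0" "G \<alpha> = 0" using Suc.prems(3) Suc.prems(4)[of 0] by auto
  obtain H where H: "H holomorphic_on right_half_plane"
    "\<And>z. z \<in> right_half_plane \<Longrightarrow> cmod (H z) \<le> M"
    "\<And>z. z \<in> right_half_plane \<Longrightarrow> G z = (z - \<alpha>) / (z + \<alpha>) * H z"
    using half_plane_divide_zero[OF Suc.prems(1,2) a0] by blast
  \<comment> \<open>The Blaschke factor of \<open>\<alpha>\<close> does not vanish at the later
    zeros, so \<open>H\<close> inherits the progression that starts at
    \<open>\<alpha> + 2\<close>.\<close>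
  have zeros: "H (of_real (\<alpha> + 2 + 2 * real n)) = 0" for n :: nat
  proof -
    have "0 = G (of_real (\<alpha> + 2 * real (Suc n)))" by (rule Suc.prems(4)[symmetric])
    also have "of_real (\<alpha> + 2 * real (Suc n)) = complex_of_real (\<alpha> + 2 + 2 * real n)"
      by (simp add: algebra_simps)
    also have "G \<dots> = (of_real (\<alpha> + 2 + 2 * real n) - of_real \<alpha>) / (of_real (\<alpha> + 2 + 2 * real n) + of_real \<alpha>)
        * H (of_real (\<alpha> + 2 + 2 * real n))"
      using a0 by (intro H(3)) (simp add: add_pos_nonneg)
    also have "(of_real (\<alpha> + 2 + 2 * real n) - complex_of_real \<alpha>) / (of_real (\<alpha> + 2 + 2 * real n) + complex_of_real \<alpha>)
        = of_real ((2 + 2 * real n) / (2 * \<alpha> + 2 + 2 * real n))"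
      by (simp add: algebra_simps)
    finally have "complex_of_real ((2 + 2 * real n) / (2 * \<alpha> + 2 + 2 * real n))
        * H (of_real (\<alpha> + 2 + 2 * real n)) = 0" by (rule sym)
    moreover have "(2 + 2 * real n) / (2 * \<alpha> + 2 + 2 * real n) > 0"
      using a0 by (intro divide_pos_pos add_pos_nonneg) auto
    ultimately show ?thesis by (metis less_irrefl mult_eq_0_iff of_real_eq_0_iff)
  qed
  have IH: "cmod (H 1) \<le> M * (\<alpha> + 2 - 1) / (\<alpha> + 2 + 2 * real N - 1)"
    using Suc.prems(3) by (intro Suc.IH H zeros) auto
  have "cmod (G 1) = cmod (of_real ((1 - \<alpha>) / (1 + \<alpha>))) * cmod (H 1)"
    using H(3)[of 1] by (simp add: norm_mult norm_divide)
  also have "cmod (of_real ((1 - \<alpha>) / (1 + \<alpha>))) = (\<alpha> - 1) / (\<alpha> + 1)"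
    unfolding norm_of_real using Suc.prems(3) by (simp add: abs_if field_simps)
  also have "(\<alpha> - 1) / (\<alpha> + 1) * cmod (H 1)
      \<le> (\<alpha> - 1) / (\<alpha> + 1) * (M * (\<alpha> + 2 - 1) / (\<alpha> + 2 + 2 * real N - 1))"
    using Suc.prems(3) by (intro mult_left_mono IH) auto
  also have "\<dots> = M * (\<alpha> - 1) / (\<alpha> + 2 * real (Suc N) - 1)"
  proof -
    \<comment> \<open>The telescoping: the new denominator \<open>\<alpha> + 1\<close> cancels the
      numerator supplied by the induction hypothesis.\<close>
    have "(\<alpha> - 1) / (\<alpha> + 1) * (M * (\<alpha> + 1) / D) = M * (\<alpha> - 1) / D" for D
      using Suc.prems(3) by simp
    moreover have "\<alpha> + 2 - 1 = \<alpha> + 1" "\<alpha> + 2 + 2 * real N - 1 = \<alpha> + 2 * real (Suc N) - 1"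
      by auto
    ultimately show ?thesis by (simp only:)
  qed
  finally show ?case .
qed

text \<open>Since \<open>g\<close> is bounded only on \<open>Re z \<ge> d\<close>, the origin is
  moved to \<open>Complex d (Im a)\<close>, which also puts the zeros on the real axis. The
  resulting bound is of order \<open>1/N\<close>, so \<open>g\<close> vanishes at
  \<open>Complex (1 + d) (Im a)\<close>; varying \<open>d\<close> gives a whole segment of
  zeros.\<close>

lemma progression_zeros_imp_zero:
  assumes g: "g holomorphic_on right_half_plane"
    and bdd: "\<And>d. d > 0 \<Longrightarrow> \<exists>M. \<forall>z. Re z \<ge> d \<longrightarrow> cmod (g z) \<le> M"
    and a: "Re a > 0" and zeros: "\<And>n::nat. g (a + 2 * of_nat n) = 0" and z: "Re z > 0"
  shows "g z = 0"
proof -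
  have seg: "g (Complex (1 + d) (Im a)) = 0" if d: "0 < d" "d < 1" for d
  proof -
    obtain M where M: "\<And>z. Re z \<ge> d \<Longrightarrow> cmod (g z) \<le> M" using bdd[OF d(1)] by blast
    define G where "G = (\<lambda>z. g (z + Complex d (Im a)))"
    \<comment> \<open>The progression starts at the second zero \<open>a + 2\<close>, which ensures
      \<open>\<alpha> > 1\<close>.\<close>
    define \<alpha> where "\<alpha> = Re a + 2 - d"
    have \<alpha>: "\<alpha> > 1" using a d by (simp add: \<alpha>_def)
    have "(g \<circ> (\<lambda>z. z + Complex d (Im a))) holomorphic_on right_half_plane"
      by (intro holomorphic_on_compose_gen[OF _ g] holomorphic_intros) (use d in auto)
    then have holG: "G holomorphic_on right_half_plane" by (simp add: G_def o_def)
    have zG: "G (of_real (\<alpha> + 2 * real n)) = 0" for n :: nat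
    proof -
      have "of_real (\<alpha> + 2 * real n) + Complex d (Im a) = a + 2 * of_nat (Suc n)"
        by (simp add: complex_eq_iff \<alpha>_def)
      then show ?thesis unfolding G_def by (simp only: zeros)
    qed
    have bound: "cmod (G 1) \<le> M * (\<alpha> - 1) / (\<alpha> + 2 * real N - 1)" for N
      by (rule half_plane_progression_zeros_bound[OF holG _ \<alpha> zG]) (auto simp: G_def intro!: M)
    have "(\<lambda>N. M * (\<alpha> - 1) / (\<alpha> + 2 * real N - 1)) \<longlonglongrightarrow> 0"
      by real_asymp
    then have "cmod (G 1) \<le> 0"
      by (rule tendsto_lowerbound) (use bound in auto)
    moreover have "1 + Complex d (Im a) = Complex (1 + d) (Im a)" by (simp add: complex_eq_iff)
    ultimately show ?thesis by (simp add: G_def)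
  qed
  let ?U = "{Complex (1 + d) (Im a) | d. 0 < d \<and> d < 1}"
  show ?thesis
  proof (rule analytic_continuation[OF g right_half_plane_open right_half_plane_connected])
    show "Complex 1 (Im a) islimpt ?U"
      unfolding islimpt_approachable
    proof (intro allI impI)
      fix e :: real assume e: "e > 0"
      define d where "d = min (e/2) (1/2)"
      have d: "0 < d" "d < 1" "d < e" using e by (auto simp: d_def)
      have "Complex (1 + d) (Im a) - Complex 1 (Im a) = of_real d" by (simp add: complex_eq_iff)
      then have "dist (Complex (1 + d) (Im a)) (Complex 1 (Im a)) < e"
        using d unfolding dist_norm by simp
      then show "\<exists>x'\<in>?U. x' \<noteq> Complex 1 (Im a) \<and> dist x' (Complex 1 (Im a)) < e"
        using d by (intro bexI[of _ "Complex (1 + d) (Im a)"]) auto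
    qed
  qed (use seg z in auto)
qed

section \<open>Vanishing boundary values\<close>

text \<open>Double-angle formulas. The angle \<open>pi - 2 * arctan v\<close> thus gives the
  boundary correspondence between the imaginary axis and the circle without the point 1.\<close>

lemma cayley_unit_circle:
  "(1 + cis (pi - 2 * arctan v)) / (1 - cis (pi - 2 * arctan v)) = \<i> * of_real v"
proof -
  let ?a = "arctan v"
  have c: "cos ?a \<noteq> 0" using cos_gt_zero_pi arctan_lbound arctan_ubound by (metis less_irrefl)
  have ne: "1 + cis (- (2 * ?a)) \<noteq> 0"
  proof
    assume "1 + cis (- (2 * ?a)) = 0"
    then have "1 + cos (2 * ?a) = 0" by (simp add: complex_eq_iff)
    then show False using c by (simp add: cos_double_cos)
  qed
  have v: "sin ?a = v * cos ?a" using c tan_arctan[of v] by (simp add: tan_def field_simps)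
  have re: "1 - cos (2 * ?a) = v * sin (2 * ?a)"
    by (simp add: cos_double_sin sin_double v power2_eq_square)
  have im: "sin (2 * ?a) = v * (1 + cos (2 * ?a))"
    by (simp add: cos_double_cos sin_double v power2_eq_square)
  have "1 - cis (- (2 * ?a)) = \<i> * of_real v * (1 + cis (- (2 * ?a)))"
    using re im by (simp add: complex_eq_iff)
  moreover have "cis (pi - 2 * ?a) = - cis (- (2 * ?a))"
    by (simp add: complex_eq_iff)
  ultimately show ?thesis using ne by (simp add: field_simps)
qed

text \<open>Change of variables along that correspondence. The weight is the absolute Jacobian,
  which is \<open>2*pi\<close> times the Poisson kernel of the half-plane at distance 1 from its
  boundary.\<close>

lemma integral_circle_to_line:
  fixes f :: "real \<Rightarrow> real" and y0 :: real
  assumes f: "f absolutely_integrable_on {0<..<2*pi}"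
    and meas: "(\<lambda>y. f (pi - 2 * arctan (y - y0))) \<in> borel_measurable borel"
  shows "integrable lborel (\<lambda>y. 2 / (1 + (y - y0)\<^sup>2) * f (pi - 2 * arctan (y - y0)))" (is "integrable _ ?h")
    and "(LINT y|lborel. 2 / (1 + (y - y0)\<^sup>2) * f (pi - 2 * arctan (y - y0))) = integral {0<..<2*pi} f"
proof -
  let ?\<theta> = "\<lambda>y. pi - 2 * arctan (y - y0)"
  let ?\<theta>' = "\<lambda>y. - (2 / (1 + (y - y0)\<^sup>2))"
  have im: "range ?\<theta> = {0<..<2*pi}"
  proof (intro equalityI subsetI)
    fix t assume "t \<in> range ?\<theta>"
    then obtain y where "t = pi - 2 * arctan (y - y0)" by auto
    then show "t \<in> {0<..<2*pi}" using arctan_lbound[of "y - y0"] arctan_ubound[of "y - y0"] by simp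
  next
    fix t :: real assume t: "t \<in> {0<..<2*pi}"
    have "arctan (tan ((pi - t)/2)) = (pi - t)/2" using t by (intro arctan_tan) auto
    then have "t = ?\<theta> (y0 + tan ((pi - t)/2))" by simp
    then show "t \<in> range ?\<theta>" by blast
  qed
  have der: "(?\<theta> has_field_derivative ?\<theta>' y) (at y within UNIV)" for y
    by (auto intro!: derivative_eq_intros simp: field_simps)
  have inj: "inj ?\<theta>" by (auto simp: inj_def arctan_eq_iff)
  have abs: "\<bar>?\<theta>' y\<bar> = 2 / (1 + (y - y0)\<^sup>2)" for y by simp
  have "?h absolutely_integrable_on UNIV \<and> integral UNIV ?h = integral {0<..<2*pi} f"
    using has_absolute_integral_change_of_variables_1'[of UNIV ?\<theta> ?\<theta>' f "integral {0<..<2*pi} f"] der inj f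
    unfolding abs im by simp
  then have ab: "integrable lebesgue ?h" and eq: "integral UNIV ?h = integral {0<..<2*pi} f"
    by (auto simp: set_integrable_def)
  \<comment> \<open>The change of variables gives integrability for the completed measure; Borel
    measurability brings it back to \<open>lborel\<close>.\<close>
  have "?h \<in> borel_measurable borel" using meas by measurable
  then show i: "integrable lborel ?h" using ab by (simp add: integrable_completion)
  show "(LINT y|lborel. 2 / (1 + (y - y0)\<^sup>2) * f (pi - 2 * arctan (y - y0))) = integral {0<..<2*pi} f"
    using integral_lborel[OF i] eq by simp
qed

text \<open>The circle mean inequality is pulled back from the disc to the half-plane
  \<open>Re z > x\<close>, with radii tending to 1. The majorant
  \<open>ln (1 + cmod (g z) / \<epsilon>)\<close> of \<open>ln (cmod (g z) / \<epsilon>)\<close>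
  stays continuous and nonnegative at zeros of \<open>g\<close>.\<close>

lemma half_plane_jensen:
  assumes g: "g holomorphic_on right_half_plane" and x: "x > 0"
    and M: "\<And>z. Re z \<ge> x \<Longrightarrow> cmod (g z) \<le> M" and e: "\<epsilon> > 0"
  shows "integrable lborel (\<lambda>y. 2 / (1 + (y - y0)\<^sup>2) * ln (1 + cmod (g (Complex x y)) / \<epsilon>))"
    and "cmod (g (Complex (1 + x) y0)) \<le>
      \<epsilon> * exp ((LINT y|lborel. 2 / (1 + (y - y0)\<^sup>2) * ln (1 + cmod (g (Complex x y)) / \<epsilon>)) / (2*pi))"
proof -
  define \<phi> where "\<phi> = (\<lambda>w. Complex x y0 + (1 + w) / (1 - w))"
  define F where "F = (\<lambda>w. g (\<phi> w))"
  have phi: "Re (\<phi> w) \<ge> x" if "norm w < 1" for w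
    using Re_cayley_pos[OF that] by (simp add: \<phi>_def del: Re_divide)
  have phi1: "\<phi> (cis (pi - 2 * arctan (y - y0))) = Complex x y" for y
    unfolding \<phi>_def cayley_unit_circle by (simp add: complex_eq_iff)
  have circ: "pi - 2 * arctan (tan ((pi - t)/2)) = t" if t: "t \<in> {0<..<2*pi}" for t
  proof -
    have "arctan (tan ((pi - t)/2)) = (pi - t)/2" using t by (intro arctan_tan) auto
    then show ?thesis by simp
  qed
  have phi_cis: "Re (\<phi> (cis t)) = x" if t: "t \<in> {0<..<2*pi}" for t
    using phi1[of "y0 + tan ((pi - t)/2)"] circ[OF t] by simp
  have cis_ne: "cis t \<noteq> 1" if t: "t \<in> {0<..<2*pi}" for t
  proof
    assume 1: "cis t = 1"
    have "\<i> * of_real (tan ((pi - t)/2)) = 0"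
      using cayley_unit_circle[of "tan ((pi - t)/2)"] unfolding circ[OF t] 1 by simp
    then have "t = pi" using circ[OF t] by simp
    then show False using 1 by simp
  qed
  have holF: "F holomorphic_on ball 0 1"
  proof -
    have "(g \<circ> \<phi>) holomorphic_on ball 0 1"
    proof (rule holomorphic_on_compose_gen[OF _ g])
      show "\<phi> holomorphic_on ball 0 1" unfolding \<phi>_def by (intro holomorphic_intros) auto
      show "\<phi> ` ball 0 1 \<subseteq> right_half_plane" using phi x by fastforce
    qed
    then show ?thesis by (simp add: F_def o_def)
  qed
  define r :: "nat \<Rightarrow> real" where "r = (\<lambda>n. 1 - 1 / (real n + 2))"
  have r: "0 < r n" "r n < 1" for n by (auto simp: r_def field_simps)
  have rlim: "r \<longlonglongrightarrow> 1" unfolding r_def by real_asymp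
  define L where "L = (\<lambda>w. ln (1 + cmod (F w) / \<epsilon>))"
  have contL: "continuous_on (ball 0 1) L"
    unfolding L_def
    by (intro continuous_intros holomorphic_on_imp_continuous_on[OF holF]) (use e in \<open>auto simp: add_pos_nonneg less_imp_neq[symmetric] intro!: add_pos_nonneg\<close>)
  have L0: "L w \<ge> 0" for w using e by (simp add: L_def)
  have LM: "L w \<le> ln (1 + M / \<epsilon>)" if "norm w < 1" for w
    using M[OF phi[OF that]] e unfolding L_def F_def
    by (intro ln_mono) (auto simp: divide_right_mono add_pos_nonneg intro!: add_pos_nonneg)
  have step: "cmod (F 0) / \<epsilon> \<le> exp (integral {0<..<2*pi} (\<lambda>t. L (r n * cis t)) / (2*pi))" for n
  proof -
    have sub: "cball 0 (r n) \<subseteq> ball (0::complex) 1" using r(2)[of n] by auto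
    have "norm ((\<lambda>w. F w / \<epsilon>) 0) \<le> exp (integral {0..2*pi} (\<lambda>t. L (r n * cis t)) / (2*pi))"
    proof (rule norm_center_le_exp_mean)
      show "(\<lambda>w. F w / \<epsilon>) holomorphic_on ball 0 (r n)"
        using e sub by (intro holomorphic_intros holomorphic_on_subset[OF holF]) auto
      show "continuous_on (cball 0 (r n)) (\<lambda>w. F w / \<epsilon>)"
        using e sub by (intro continuous_intros continuous_on_subset[OF holomorphic_on_imp_continuous_on[OF holF]]) auto
      show "continuous_on (sphere 0 (r n)) L"
        using sub by (intro continuous_on_subset[OF contL]) auto
      show "norm (F w / \<epsilon>) \<le> exp (L w)" for w
        using e by (simp add: L_def norm_divide add_pos_nonneg)
    qed (use r in auto)
    then show ?thesis using e by (simp add: norm_divide integral_open_interval_real)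
  qed
  \<comment> \<open>Only \<open>cis t = 1\<close>, which corresponds to infinity, is a singular
    point of \<open>\<phi>\<close> on the circle; elsewhere the radial limit follows from continuity
    of \<open>g\<close> on the line \<open>Re z = x\<close>.\<close>
  have Lcis: "(\<lambda>n. L (r n * cis t)) \<longlonglongrightarrow> L (cis t)" if t: "t \<in> {0<..<2*pi}" for t
  proof -
    have "isCont g (\<phi> (cis t))"
      using holomorphic_on_imp_continuous_on[OF g] phi_cis[OF t] x
      by (auto simp: continuous_on_eq_continuous_at)
    moreover have "(\<lambda>n. \<phi> (r n * cis t)) \<longlonglongrightarrow> \<phi> (1 * cis t)"
      unfolding \<phi>_def using cis_ne[OF t]
      by (intro tendsto_intros) (use rlim in \<open>auto intro!: tendsto_eq_intros\<close>)
    ultimately have "(\<lambda>n. F (r n * cis t)) \<longlonglongrightarrow> F (cis t)"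
      unfolding F_def using isCont_tendsto_compose by fastforce
    moreover have "1 + cmod (F (cis t)) / \<epsilon> \<noteq> 0"
      using e by (metis add_pos_nonneg divide_nonneg_pos less_irrefl norm_ge_zero zero_less_one)
    ultimately show ?thesis
      unfolding L_def using e by (intro tendsto_intros) auto
  qed
  have intL: "(\<lambda>t. L (r n * cis t)) integrable_on {0<..<2*pi}" for n
  proof -
    have "continuous_on {0..2*pi} (\<lambda>t. L (r n * cis t))"
      by (intro continuous_on_compose2[OF contL] continuous_intros) (use r[of n] in \<open>auto simp: norm_mult\<close>)
    then show ?thesis
      using integrable_continuous_interval integrable_on_open_interval_real by blast
  qed
  have dc: "(\<lambda>t. L (cis t)) integrable_on {0<..<2*pi}"
    "(\<lambda>n. integral {0<..<2*pi} (\<lambda>t. L (r n * cis t))) \<longlonglongrightarrow> integral {0<..<2*pi} (\<lambda>t. L (cis t))"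
  proof -
    \<comment> \<open>The bound \<open>M\<close> supplies a constant majorant for dominated
      convergence.\<close>
    have c: "(\<lambda>t. ln (1 + M / \<epsilon>)) integrable_on {0<..<2*pi}"
      using integrable_on_open_interval_real by blast
    have b: "norm (L (r n * cis t)) \<le> ln (1 + M / \<epsilon>)" for n t
      using LM[of "r n * cis t"] L0[of "r n * cis t"] r[of n] by (simp add: norm_mult)
    show "(\<lambda>t. L (cis t)) integrable_on {0<..<2*pi}"
      "(\<lambda>n. integral {0<..<2*pi} (\<lambda>t. L (r n * cis t))) \<longlonglongrightarrow> integral {0<..<2*pi} (\<lambda>t. L (cis t))"
      by (rule dominated_convergence[OF intL c b Lcis]; simp)+
  qed
  have abs: "(\<lambda>t. L (cis t)) absolutely_integrable_on {0<..<2*pi}"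
    by (rule nonnegative_absolutely_integrable_1[OF dc(1) L0])
  have Leq: "L (cis (pi - 2 * arctan (y - y0))) = ln (1 + cmod (g (Complex x y)) / \<epsilon>)" for y
    unfolding L_def F_def phi1 ..
  have meas: "(\<lambda>y. L (cis (pi - 2 * arctan (y - y0)))) \<in> borel_measurable borel"
  proof -
    have "continuous_on UNIV (\<lambda>y. g (Complex x y))"
      by (rule continuous_on_vertical_line[OF g x continuous_on_id])
    then have [measurable]: "(\<lambda>y. g (Complex x y)) \<in> borel_measurable borel"
      by (rule borel_measurable_continuous_onI)
    show ?thesis unfolding Leq by measurable
  qed
  note ctl = integral_circle_to_line[OF abs meas, unfolded Leq]
  show "integrable lborel (\<lambda>y. 2 / (1 + (y - y0)\<^sup>2) * ln (1 + cmod (g (Complex x y)) / \<epsilon>))"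
    by (rule ctl(1))
  have "cmod (F 0) / \<epsilon> \<le> exp (integral {0<..<2*pi} (\<lambda>t. L (cis t)) / (2*pi))"
    by (rule tendsto_lowerbound[where f="\<lambda>n. exp (integral {0<..<2*pi} (\<lambda>t. L (r n * cis t)) / (2*pi))"])
       (use dc(2) step in \<open>auto intro!: tendsto_intros\<close>)
  moreover have "F 0 = g (Complex (1 + x) y0)"
  proof -
    have "\<phi> 0 = Complex (1 + x) y0" by (simp add: \<phi>_def complex_eq_iff)
    then show ?thesis by (simp add: F_def)
  qed
  ultimately show "cmod (g (Complex (1 + x) y0)) \<le>
      \<epsilon> * exp ((LINT y|lborel. 2 / (1 + (y - y0)\<^sup>2) * ln (1 + cmod (g (Complex x y)) / \<epsilon>)) / (2*pi))"
    unfolding ctl(2) using e by (simp add: pos_divide_le_eq mult.commute)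
qed

text \<open>Jensen's inequality is applied on lines approaching the imaginary axis. The logarithm
  splits into a truncated part, whose integral tends to 0 by dominated convergence, and a part
  controlled by the H^1 norm. This gives \<open>\<epsilon> * exp (C / pi)\<close> as a bound for
  every \<open>\<epsilon>\<close>.\<close>

lemma hardy1_boundary_zero_imp_zero:
  assumes g: "g \<in> hardy1_rhp" and bv: "AE y in lborel. has_boundary_value g y 0" and z: "Re z > 0"
  shows "g z = 0"
proof -
  note hol = hardy1_holomorphic[OF g]
  obtain C where C0: "C \<ge> 0" and
    C: "\<And>x. x > 0 \<Longrightarrow> (\<integral>\<^sup>+ y. ennreal (cmod (g (Complex x y))) \<partial>lborel) \<le> ennreal C"
    using hardy1_nn_integral_le[OF g] by blast
  define x where "x = (\<lambda>n. 1 / (real n + 1))"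
  have x: "x n > 0" for n by (simp add: x_def)
  have xlim: "x \<longlonglongrightarrow> 0" unfolding x_def by real_asymp
  then have xright: "filterlim x (at_right 0) sequentially"
    using x less_imp_neq[OF x, symmetric] by (auto simp: filterlim_at intro!: always_eventually)
  define T where "T = (\<lambda>n y. cmod (g (Complex (x n) y)))"
  have [measurable]: "T n \<in> borel_measurable borel" for n
    unfolding T_def
    by (intro borel_measurable_continuous_onI continuous_intros continuous_on_vertical_line[OF hol x])
  have T0: "T n y \<ge> 0" for n y by (simp add: T_def)
  have intT: "integrable lborel (T n)" "(LINT y|lborel. T n y) \<le> C" for n
  proof -
    have le: "(\<integral>\<^sup>+ y. ennreal (T n y) \<partial>lborel) \<le> ennreal C" using C[OF x] by (simp add: T_def)
    then show i: "integrable lborel (T n)"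
      by (intro integrableI_bounded) (auto simp: T0 intro: le_less_trans)
    show "(LINT y|lborel. T n y) \<le> C"
      using le C0 nn_integral_eq_integral[OF i] T0 by auto
  qed
  have line: "g (Complex 1 y0) = 0" for y0
  proof -
    define W where "W = (\<lambda>y::real. 2 / (1 + (y - y0)\<^sup>2))"
    have [measurable]: "W \<in> borel_measurable borel" unfolding W_def by measurable
    have W: "0 \<le> W y" "W y \<le> 2" for y
      by (auto simp: W_def divide_le_eq add_pos_nonneg)
    have bound: "cmod (g (Complex 1 y0)) \<le> \<epsilon> * exp (C / pi)" if e: "\<epsilon> > 0" for \<epsilon>
    proof -
      \<comment> \<open>The kernel is the image of the constant 1 on the circle.\<close>
      have "integrable lborel W"
        using integral_circle_to_line(1)[of "\<lambda>_. 1" y0]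
        by (auto simp: W_def intro: nonnegative_absolutely_integrable_1)
      then have intW: "integrable lborel (\<lambda>y. W y * ln (1 + 1 / \<epsilon>))"
        by (rule integrable_mult_left)
      \<comment> \<open>Truncating \<open>T n y\<close> at 1 gives an integrable majorant
        independent of \<open>n\<close>.\<close>
      define A where "A = (\<lambda>n y. W y * ln (1 + min (T n y) 1 / \<epsilon>))"
      have [measurable]: "A n \<in> borel_measurable borel" for n unfolding A_def by measurable
      have A: "norm (A n y) \<le> W y * ln (1 + 1 / \<epsilon>)" for n y
      proof -
        have "0 \<le> ln (1 + min (T n y) 1 / \<epsilon>)" using e T0[of n y] by simp
        moreover have "ln (1 + min (T n y) 1 / \<epsilon>) \<le> ln (1 + 1 / \<epsilon>)"
          using e T0[of n y] by (intro ln_mono) (auto intro!: add_pos_nonneg divide_right_mono)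
        ultimately show ?thesis using W[of y] by (auto simp: A_def intro!: mult_left_mono)
      qed
      have intA: "integrable lborel (A n)" for n
        by (rule Bochner_Integration.integrable_bound[OF intW]) (use A in \<open>auto intro!: AE_I2 order_trans[OF _ abs_ge_self]\<close>)
      have limA: "(\<lambda>n. LINT y|lborel. A n y) \<longlonglongrightarrow> (LINT y::real|lborel. (0::real))"
      proof (rule integral_dominated_convergence[where f="\<lambda>_. 0" and s=A and w="\<lambda>y. W y * ln (1 + 1 / \<epsilon>)"])
        show "AE y in lborel. (\<lambda>n. A n y) \<longlonglongrightarrow> 0"
          using bv
        proof eventually_elim
          case (elim y)
          have "(\<lambda>n. g (Complex (x n) y)) \<longlonglongrightarrow> 0"
            using elim filterlim_compose[OF _ xright] unfolding has_boundary_value_def by blast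
          then have "(\<lambda>n. T n y) \<longlonglongrightarrow> 0" unfolding T_def using tendsto_norm_zero by blast
          then have "(\<lambda>n. A n y) \<longlonglongrightarrow> W y * ln (1 + min 0 1 / \<epsilon>)"
            unfolding A_def using e by (intro tendsto_intros) auto
          then show ?case by simp
        qed
      qed (use intW A in auto)
      have le: "cmod (g (Complex (1 + x n) y0)) \<le> \<epsilon> * exp (((LINT y|lborel. A n y) + 2 * C) / (2*pi))" for n
      proof -
        obtain M where M: "\<And>z. Re z \<ge> x n \<Longrightarrow> cmod (g z) \<le> M" using hardy1_bounded[OF g x[of n]] by blast
        note J = half_plane_jensen[OF hol x M e, of n y0]
        have "(LINT y|lborel. W y * ln (1 + T n y / \<epsilon>)) \<le> (LINT y|lborel. A n y + 2 * T n y)"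
        proof (rule integral_mono)
          show "integrable lborel (\<lambda>y. W y * ln (1 + T n y / \<epsilon>))" unfolding W_def T_def by (rule J(1))
          show "integrable lborel (\<lambda>y. A n y + 2 * T n y)" using intA intT by auto
          show "W y * ln (1 + T n y / \<epsilon>) \<le> A n y + 2 * T n y" for y
          proof -
            \<comment> \<open>Where \<open>T n y > 1\<close>, the factor
              \<open>1 + 1 / \<epsilon>\<close> is split off and \<open>ln t \<le> t\<close> is used
              for the rest.\<close>
            have "ln (1 + T n y / \<epsilon>) \<le> ln (1 + min (T n y) 1 / \<epsilon>) + T n y"
            proof (cases "T n y \<le> 1")
              case False
              then have t: "T n y > 1" by simp
              have "1 + T n y / \<epsilon> \<le> (1 + 1 / \<epsilon>) * T n y"
                using t e by (simp add: field_simps)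
              then have "ln (1 + T n y / \<epsilon>) \<le> ln ((1 + 1 / \<epsilon>) * T n y)"
                using t e by (intro ln_mono) (auto intro!: add_pos_nonneg mult_pos_pos)
              also have "\<dots> = ln (1 + 1 / \<epsilon>) + ln (T n y)"
                using t e by (intro ln_mult_pos) (auto intro!: add_pos_nonneg)
              also have "ln (T n y) \<le> T n y" using t ln_le_minus_one[of "T n y"] by linarith
              finally show ?thesis using t by simp
            qed (use T0 in auto)
            then have "W y * ln (1 + T n y / \<epsilon>) \<le> W y * (ln (1 + min (T n y) 1 / \<epsilon>) + T n y)"
              using W by (intro mult_left_mono) auto
            also have "\<dots> = A n y + W y * T n y" by (simp add: A_def distrib_left)
            also have "\<dots> \<le> A n y + 2 * T n y" using W T0 by (intro add_left_mono mult_right_mono) auto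
            finally show ?thesis .
          qed
        qed
        also have "\<dots> = (LINT y|lborel. A n y) + 2 * (LINT y|lborel. T n y)"
          using intA intT by simp
        also have "\<dots> \<le> (LINT y|lborel. A n y) + 2 * C" using intT(2) by simp
        finally have "(LINT y|lborel. W y * ln (1 + T n y / \<epsilon>)) \<le> (LINT y|lborel. A n y) + 2 * C" .
        then have "\<epsilon> * exp ((LINT y|lborel. W y * ln (1 + T n y / \<epsilon>)) / (2*pi))
            \<le> \<epsilon> * exp (((LINT y|lborel. A n y) + 2 * C) / (2*pi))"
          using e by (intro mult_left_mono) (auto intro!: divide_right_mono)
        then show ?thesis using J(2) unfolding W_def T_def by (rule order_trans[rotated])
      qed
      have "(\<lambda>n. cmod (g (Complex (1 + x n) y0))) \<longlonglongrightarrow> cmod (g (Complex (1 + 0) y0))"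
      proof -
        have "isCont g (Complex 1 y0)"
          using holomorphic_on_imp_continuous_on[OF hol] by (auto simp: continuous_on_eq_continuous_at)
        moreover have "(\<lambda>n. Complex (1 + x n) y0) \<longlonglongrightarrow> Complex (1 + 0) y0"
          by (intro tendsto_Complex tendsto_intros xlim)
        ultimately show ?thesis
          by (intro tendsto_norm isCont_tendsto_compose[of _ g]) simp_all
      qed
      moreover have "(\<lambda>n. \<epsilon> * exp (((LINT y|lborel. A n y) + 2 * C) / (2*pi))) \<longlonglongrightarrow> \<epsilon> * exp ((0 + 2 * C) / (2*pi))"
        using limA by (intro tendsto_intros) auto
      ultimately have "cmod (g (Complex (1 + 0) y0)) \<le> \<epsilon> * exp ((0 + 2 * C) / (2*pi))"
        by (rule LIMSEQ_le) (use le in auto)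
      then show ?thesis by simp
    qed
    have "cmod (g (Complex 1 y0)) \<le> 0"
    proof (rule field_le_epsilon)
      fix e :: real assume "e > 0"
      then show "cmod (g (Complex 1 y0)) \<le> 0 + e"
        using bound[of "e / exp (C / pi)"] by simp
    qed
    then show ?thesis by simp
  qed
  show ?thesis
    by (rule uncountable_vertical_zeros_imp_zero[OF hol _ uncountable_UNIV_real line z]) simp
qed

section \<open>Quotients with periodic divisor\<close>

text \<open>Comparing orders in \<open>per\<close> shows that \<open>zorder g - zorder f\<close> has
  period 2. A positive value at \<open>a\<close> would make \<open>g\<close> vanish at all points
  \<open>a + 2 * of_nat n\<close>, which is impossible for a nonzero \<open>g\<close> with these
  bounds.\<close>

lemma zorder_le_of_quotient_periodic:
  assumes f: "f holomorphic_on right_half_plane" and g: "g holomorphic_on right_half_plane"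
    and fnz: "\<exists>w\<in>right_half_plane. f w \<noteq> 0" and gnz: "\<exists>w\<in>right_half_plane. g w \<noteq> 0"
    and bdd: "\<And>d. d > 0 \<Longrightarrow> \<exists>M. \<forall>z. Re z \<ge> d \<longrightarrow> cmod (g z) \<le> M"
    and per: "\<And>s. Re s > 0 \<Longrightarrow> f s * g (s + 2) = g s * f (s + 2)"
    and a: "Re a > 0"
  shows "zorder g a \<le> zorder f a"
proof (rule ccontr)
  assume "\<not> ?thesis"
  then have gt: "zorder f a < zorder g a" by simp
  \<comment> \<open>Orders are nonnegative, and positive exactly at zeros; hence a positive
    difference forces a zero of \<open>g\<close>.\<close>
  have sgn: "if u b = 0 then zorder u b > 0 else zorder u b = 0"
    if "u holomorphic_on right_half_plane" "\<exists>w\<in>right_half_plane. u w \<noteq> 0" "Re b > 0" for u b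
    using zorder_exist_zero[of u right_half_plane b] that right_half_plane_connected by simp
  have ev: "\<forall>\<^sub>F w in at b. u w \<noteq> 0"
    if u: "u holomorphic_on right_half_plane" "\<exists>w\<in>right_half_plane. u w \<noteq> 0" "Re b > 0" for u b
  proof -
    obtain \<beta> where \<beta>: "\<beta> \<in> right_half_plane" "u \<beta> \<noteq> 0" using u(2) by blast
    have "\<forall>\<^sub>F w in at b. u w \<noteq> 0 \<and> w \<in> right_half_plane"
      by (rule non_zero_neighbour_alt[OF u(1) right_half_plane_open right_half_plane_connected _ \<beta>])
         (use u(3) in simp)
    then show ?thesis by eventually_elim simp
  qed
  have an: "u analytic_on {b}" if "u holomorphic_on right_half_plane" "Re b > 0" for u b
    using that by (auto simp: analytic_at intro!: exI[of _ right_half_plane])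
  have shift: "zorder (\<lambda>s. u (s + 2)) b = zorder u (b + 2)" for u b
    using zorder_shift[of "\<lambda>s. u (s + 2)" b] zorder_shift[of u "b + 2"] by (simp add: add.assoc)
  have an2: "(\<lambda>s. u (s + 2)) analytic_on {b}" if "u holomorphic_on right_half_plane" "Re b > 0" for u b
  proof -
    have "(u \<circ> (\<lambda>s. s + 2)) holomorphic_on right_half_plane"
      by (intro holomorphic_on_compose_gen[OF _ that(1)] holomorphic_intros) auto
    then show ?thesis using an[of "u \<circ> (\<lambda>s. s + 2)" b] that by (simp add: o_def)
  qed
  have ev2: "\<forall>\<^sub>F w in at b. u (w + 2) \<noteq> 0"
    if "u holomorphic_on right_half_plane" "\<exists>w\<in>right_half_plane. u w \<noteq> 0" "Re b > 0" for u b
  proof -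
    have "\<forall>\<^sub>F w in at (b + 2). u w \<noteq> 0" using that by (intro ev) auto
    then show ?thesis by (simp add: at_to_0[of "b + 2"] at_to_0[of b] eventually_filtermap add.assoc)
  qed
  have step: "zorder g (b + 2) - zorder f (b + 2) = zorder g b - zorder f b" if b: "Re b > 0" for b
  proof -
    have "zorder (\<lambda>s. f s * g (s + 2)) b = zorder (\<lambda>s. g s * f (s + 2)) b"
    proof (rule zorder_cong)
      have "\<forall>\<^sub>F s in at b. s \<in> right_half_plane"
        using b by (intro eventually_at_in_open') auto
      then show "\<forall>\<^sub>F s in at b. f s * g (s + 2) = g s * f (s + 2)"
        by eventually_elim (simp add: per)
    qed simp
    moreover have "zorder (\<lambda>s. f s * g (s + 2)) b = zorder f b + zorder g (b + 2)"
      using eventually_conj[OF ev[OF f fnz b] ev2[OF g gnz b]]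
      by (subst zorder_times_analytic[OF an[OF f b] an2[OF g b]]) (simp_all add: shift)
    moreover have "zorder (\<lambda>s. g s * f (s + 2)) b = zorder g b + zorder f (b + 2)"
      using eventually_conj[OF ev[OF g gnz b] ev2[OF f fnz b]]
      by (subst zorder_times_analytic[OF an[OF g b] an2[OF f b]]) (simp_all add: shift)
    ultimately show ?thesis by simp
  qed
  have steps: "zorder g (a + 2 * of_nat n) - zorder f (a + 2 * of_nat n) = zorder g a - zorder f a" for n :: nat
  proof (induction n)
    case (Suc n)
    have "a + 2 * of_nat (Suc n) = (a + 2 * of_nat n) + 2" by simp
    then show ?case using step[of "a + 2 * of_nat n"] a Suc by (simp only:) simp
  qed simp
  have "g (a + 2 * of_nat n) = 0" for n :: nat
    using steps[of n] gt sgn[OF f fnz, of "a + 2 * of_nat n"] sgn[OF g gnz, of "a + 2 * of_nat n"] a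
    by (auto split: if_splits)
  then have "g w = 0" if "Re w > 0" for w
    using progression_zeros_imp_zero[OF g bdd a _ that] by blast
  then show False using gnz by auto
qed

text \<open>Near each \<open>a\<close> both functions are the same power of \<open>w - a\<close>
  times a zero-free factor, so the quotient of the factors fills the singularity of
  \<open>f / g\<close>.\<close>

lemma holomorphic_quotient_of_zorder_eq:
  assumes f: "f holomorphic_on S" and g: "g holomorphic_on S" and S: "open S" "connected S"
    and fnz: "\<exists>w\<in>S. f w \<noteq> 0" and gnz: "\<exists>w\<in>S. g w \<noteq> 0"
    and eq: "\<And>a. a \<in> S \<Longrightarrow> zorder f a = zorder g a"
  obtains h where "h holomorphic_on S" "\<And>z. z \<in> S \<Longrightarrow> h z \<noteq> 0" "\<And>z. z \<in> S \<Longrightarrow> f z = h z * g z"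
proof -
  define q where "q = (\<lambda>z. f z / g z)"
  have loc: "\<exists>P r. r > 0 \<and> P holomorphic_on ball a r \<and> (\<forall>w\<in>ball a r. P w \<noteq> 0 \<and> f w = P w * g w)
      \<and> (\<forall>w\<in>ball a r - {a}. P w = q w)" if a: "a \<in> S" for a
  proof -
    define n where "n = nat (zorder g a)"
    obtain r1 where r1: "r1 > 0" "zor_poly f a holomorphic_on cball a r1"
      "\<And>w. w \<in> cball a r1 \<Longrightarrow> f w = zor_poly f a w * (w - a) ^ n \<and> zor_poly f a w \<noteq> 0"
      using zorder_exist_zero[OF f S a fnz] unfolding n_def eq[OF a, symmetric] by blast
    obtain r2 where r2: "r2 > 0" "zor_poly g a holomorphic_on cball a r2"
      "\<And>w. w \<in> cball a r2 \<Longrightarrow> g w = zor_poly g a w * (w - a) ^ n \<and> zor_poly g a w \<noteq> 0"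
      using zorder_exist_zero[OF g S a gnz] unfolding n_def by blast
    define r where "r = min r1 r2"
    define P where "P = (\<lambda>w. zor_poly f a w / zor_poly g a w)"
    have sub: "ball a r \<subseteq> cball a r1" "ball a r \<subseteq> cball a r2" by (auto simp: r_def)
    have "P holomorphic_on ball a r"
      unfolding P_def using r1 r2 sub
      by (intro holomorphic_on_divide holomorphic_on_subset[OF r1(2)] holomorphic_on_subset[OF r2(2)]) auto
    moreover have "P w \<noteq> 0 \<and> f w = P w * g w" if "w \<in> ball a r" for w
    proof -
      have "w \<in> cball a r1" "w \<in> cball a r2" using that sub by auto
      then show ?thesis using r1(3)[of w] r2(3)[of w] unfolding P_def by auto
    qed
    moreover have "P w = q w" if "w \<in> ball a r - {a}" for w
    proof -
      have "w \<in> cball a r1" "w \<in> cball a r2" using that sub by auto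
      then show ?thesis using r1(3)[of w] r2(3)[of w] that unfolding P_def q_def by auto
    qed
    moreover have "r > 0" using r1 r2 by (simp add: r_def)
    ultimately show ?thesis by blast
  qed
  define h where "h = remove_sings q"
  have main: "h analytic_on {a} \<and> h a \<noteq> 0 \<and> f a = h a * g a" if a: "a \<in> S" for a
  proof -
    obtain P r where r: "r > 0" and P: "P holomorphic_on ball a r"
      and P1: "\<And>w. w \<in> ball a r \<Longrightarrow> P w \<noteq> 0 \<and> f w = P w * g w"
      and P2: "\<And>w. w \<in> ball a r - {a} \<Longrightarrow> P w = q w"
      using loc[OF a] by blast
    have evq: "\<forall>\<^sub>F w in at a. P w = q w"
      unfolding eventually_at using r P2 by (intro exI[of _ r]) (auto simp: dist_commute)
    have "h a = remove_sings P a"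
      unfolding h_def using evq by (intro remove_sings_cong) (auto elim: eventually_mono)
    also have "P analytic_on {a}" using P r unfolding analytic_at by (intro exI[of _ "ball a r"]) auto
    then have "remove_sings P a = P a" by simp
    finally have ha: "h a = P a" .
    have "q \<midarrow>a\<rightarrow> P a"
    proof -
      have "isCont P a" using \<open>P analytic_on {a}\<close> by (rule analytic_at_imp_isCont)
      then show ?thesis using evq unfolding isCont_def by (rule Lim_transform_eventually)
    qed
    moreover have "isolated_singularity_at q a"
    proof -
      have "q holomorphic_on ball a r - {a}"
        by (rule holomorphic_transform[OF holomorphic_on_subset[OF P] P2]) auto
      then show ?thesis using r by (intro isolated_singularity_at_holomorphic[of q "ball a r"]) auto
    qed
    ultimately have "h analytic_on {a}" unfolding h_def by (intro remove_sings_analytic_at)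
    then show ?thesis using ha P1[of a] r by auto
  qed
  have "h analytic_on S" using main analytic_on_analytic_at by blast
  then show ?thesis using that[of h] main analytic_imp_holomorphic by blast
qed

text \<open>The coefficients of positive index of a power series are determined by its real part.\<close>

lemma taylor_coeff_le_mean_Re:
  assumes K: "K holomorphic_on ball 0 1" and r: "0 < r" "r < 1" and n: "n > 0"
  shows "cmod ((deriv ^^ n) K 0 / fact n) * r ^ n \<le> integral {0..2*pi} (\<lambda>t. \<bar>Re (K (r * cis t))\<bar>) / pi"
proof -
  define c where "c = (deriv ^^ n) K 0 / fact n"
  have sub: "cball 0 r \<subseteq> ball (0::complex) 1" using r by auto
  have contK: "continuous_on (cball 0 r) K"
    using holomorphic_on_imp_continuous_on[OF K] sub continuous_on_subset by blast
  have holK: "K holomorphic_on ball 0 r"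
    using K sub ball_subset_cball holomorphic_on_subset by (metis order_trans)
  have rn: "complex_of_real r ^ n \<noteq> 0" using r by simp
  have cis_n: "cis t ^ n = cis (real n * t)" for t by (rule Complex.DeMoivre)
  have ci: "cis (- (real n * t)) * cis (real n * t) = 1" for t by (simp add: cis_mult)
  \<comment> \<open>Cauchy's formula for the \<open>n\<close>-th derivative, written as a Fourier
    integral.\<close>
  have A: "((\<lambda>t. K (r * cis t) * cis (- (real n * t))) has_integral (2 * pi * c * r ^ n)) {0..2*pi}"
  proof -
    have "((\<lambda>u. K u / (u - 0) ^ Suc n) has_contour_integral ((2 * pi * \<i>) / fact n * (deriv ^^ n) K 0)) (circlepath 0 r)"
      using r by (intro Cauchy_has_contour_integral_higher_derivative_circlepath contK holK) auto
    then have "((\<lambda>t. K (0 + r * cis t) / (0 + r * cis t - 0) ^ Suc n * r * \<i> * cis t)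
        has_integral ((2 * pi * \<i>) / fact n * (deriv ^^ n) K 0)) {0..2*pi}"
      unfolding circlepath_def by (subst (asm) has_contour_integral_part_circlepath_iff) auto
    from has_integral_mult_right[OF this, of "- \<i> * r ^ n"]
    have "((\<lambda>t. - \<i> * r ^ n * (K (0 + r * cis t) / (0 + r * cis t - 0) ^ Suc n * r * \<i> * cis t))
        has_integral (- \<i> * r ^ n * ((2 * pi * \<i>) / fact n * (deriv ^^ n) K 0))) {0..2*pi}" .
    moreover have "- \<i> * r ^ n * (K (0 + r * cis t) / (0 + r * cis t - 0) ^ Suc n * r * \<i> * cis t)
        = K (r * cis t) * cis (- (real n * t))" for t
    proof -
      have "- \<i> * r ^ n * (K (0 + r * cis t) / (0 + r * cis t - 0) ^ Suc n * r * \<i> * cis t)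
          = K (r * cis t) / cis t ^ n"
        using r by (simp add: power_mult_distrib field_simps)
      also have "\<dots> = K (r * cis t) * cis (- (real n * t))"
        unfolding cis_n using ci[of t] by (simp add: field_simps cis_cnj[symmetric] cis_mult)
      finally show ?thesis .
    qed
    moreover have "- \<i> * r ^ n * ((2 * pi * \<i>) / fact n * (deriv ^^ n) K 0) = 2 * pi * c * r ^ n"
      by (simp add: c_def field_simps)
    ultimately show ?thesis by simp
  qed
  \<comment> \<open>Cauchy's theorem: \<open>K\<close> has no Fourier modes of negative index. This
    uses \<open>n > 0\<close>.\<close>
  have B: "((\<lambda>t. K (r * cis t) * cis (real n * t)) has_integral 0) {0..2*pi}"
  proof -
    have "((\<lambda>u. K u * u ^ (n - 1)) has_contour_integral 0) (circlepath 0 r)"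
      using r sub by (intro Cauchy_theorem_disc_simple[of _ 0 1] holomorphic_intros K) auto
    then have "((\<lambda>t. K (0 + r * cis t) * (0 + r * cis t) ^ (n - 1) * r * \<i> * cis t) has_integral 0) {0..2*pi}"
      unfolding circlepath_def by (subst (asm) has_contour_integral_part_circlepath_iff) auto
    from has_integral_mult_right[OF this, of "- \<i> / r ^ n"]
    have "((\<lambda>t. - \<i> / r ^ n * (K (0 + r * cis t) * (0 + r * cis t) ^ (n - 1) * r * \<i> * cis t)) has_integral 0) {0..2*pi}"
      by simp
    moreover have "- \<i> / r ^ n * (K (0 + r * cis t) * (0 + r * cis t) ^ (n - 1) * r * \<i> * cis t)
        = K (r * cis t) * cis (real n * t)" for t
    proof -
      have "(0 + r * cis t) ^ (n - 1) * r * \<i> * cis t = \<i> * (r * cis t) ^ n"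
        using n by (cases n) (auto simp: algebra_simps)
      also have "\<dots> = \<i> * r ^ n * cis (real n * t)" by (simp add: power_mult_distrib cis_n)
      finally have *: "(0 + r * cis t) ^ (n - 1) * r * \<i> * cis t = \<i> * r ^ n * cis (real n * t)" .
      have "K (0 + r * cis t) * (0 + r * cis t) ^ (n - 1) * r * \<i> * cis t
          = K (r * cis t) * ((0 + r * cis t) ^ (n - 1) * r * \<i> * cis t)"
        by (simp add: mult.assoc)
      also note *
      finally have E: "K (0 + r * cis t) * (0 + r * cis t) ^ (n - 1) * r * \<i> * cis t
          = K (r * cis t) * (\<i> * r ^ n * cis (real n * t))" .
      have "- \<i> / a * (b * (\<i> * a * d)) = b * d" if "a \<noteq> 0" for a b d :: complex
        using that by (simp add: field_simps)
      then show ?thesis unfolding E using rn by (simp only: of_real_power)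
    qed
    ultimately show ?thesis by simp
  qed
  \<comment> \<open>The conjugate of \<open>B\<close> added to \<open>A\<close> replaces
    \<open>K\<close> by \<open>2 * Re K\<close> without changing the integral.\<close>
  have "((\<lambda>t. cnj (K (r * cis t)) * cis (- (real n * t))) has_integral 0) {0..2*pi}"
    using has_integral_cnj[THEN iffD2, OF B] by (simp add: o_def cis_cnj)
  from has_integral_add[OF A this]
  have "((\<lambda>t. of_real (2 * Re (K (r * cis t))) * cis (- (real n * t))) has_integral (2 * pi * c * r ^ n)) {0..2*pi}"
    by (simp add: complex_add_cnj flip: distrib_right)
  then have I: "integral {0..2*pi} (\<lambda>t. of_real (2 * Re (K (r * cis t))) * cis (- (real n * t))) = 2 * pi * c * r ^ n"
    and Ii: "(\<lambda>t. of_real (2 * Re (K (r * cis t))) * cis (- (real n * t))) integrable_on {0..2*pi}"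
    by (auto simp: has_integral_iff)
  have "continuous_on {0..2*pi} (\<lambda>t. 2 * \<bar>Re (K (r * cis t))\<bar>)"
    using r by (intro continuous_intros continuous_on_compose2[OF contK]) (auto simp: norm_mult)
  then have Ai: "(\<lambda>t. 2 * \<bar>Re (K (r * cis t))\<bar>) integrable_on {0..2*pi}"
    by (rule integrable_continuous_interval)
  have "cmod (2 * pi * c * r ^ n) \<le> integral {0..2*pi} (\<lambda>t. 2 * \<bar>Re (K (r * cis t))\<bar>)"
    unfolding I[symmetric] by (rule integral_norm_bound_integral[OF Ii Ai]) (simp add: norm_mult)
  then have "2 * pi * (cmod c * r ^ n) \<le> 2 * integral {0..2*pi} (\<lambda>t. \<bar>Re (K (r * cis t))\<bar>)"
    using r by (simp add: norm_mult norm_power mult.assoc)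
  then show ?thesis unfolding c_def[symmetric] by (simp add: field_simps)
qed

text \<open>Letting \<open>r\<close> tend to 1 in the coefficient estimate bounds every coefficient
  of positive index by \<open>2 * L\<close>; the power series is then compared with a geometric
  series.\<close>

lemma norm_le_of_mean_Re_bounded:
  assumes K: "K holomorphic_on ball 0 1"
    and L: "\<And>r. \<lbrakk>0 < r; r < 1\<rbrakk> \<Longrightarrow> integral {0..2*pi} (\<lambda>t. \<bar>Re (K (of_real r * cis t))\<bar>) \<le> 2 * pi * L"
    and w: "norm w < 1"
  shows "cmod (K w) \<le> cmod (K 0) + 2 * L / (1 - norm w)"
proof -
  define c where "c = (\<lambda>n. (deriv ^^ n) K 0 / fact n)"
  have c: "cmod (c n) \<le> 2 * L" if n: "n > 0" for n
  proof (rule tendsto_upperbound)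
    have "((\<lambda>r. cmod (c n) * r ^ n) \<longlongrightarrow> cmod (c n) * 1 ^ n) (at_left 1)"
      by (intro tendsto_intros)
    then show "((\<lambda>r. cmod (c n) * r ^ n) \<longlongrightarrow> cmod (c n)) (at_left 1)" by simp
    have "cmod (c n) * r ^ n \<le> 2 * L" if "r \<in> {0<..<1}" for r
    proof -
      have "cmod (c n) * r ^ n \<le> integral {0..2*pi} (\<lambda>t. \<bar>Re (K (r * cis t))\<bar>) / pi"
        unfolding c_def using that by (intro taylor_coeff_le_mean_Re K n) auto
      also have "\<dots> \<le> 2 * pi * L / pi" using that L by (intro divide_right_mono) auto
      finally show ?thesis by simp
    qed
    then show "\<forall>\<^sub>F r in at_left 1. cmod (c n) * r ^ n \<le> 2 * L"
      using eventually_at_left_real[of 0 1] by (auto elim!: eventually_mono)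
  qed simp
  have L0: "L \<ge> 0" using c[of 1] norm_ge_zero[of "c 1"] by linarith
  have sums: "(\<lambda>n. c n * w ^ n) sums K w"
    using holomorphic_power_series[OF K, of w] w by (simp add: c_def)
  then have s2: "(\<lambda>n. c (Suc n) * w ^ Suc n) sums (K w - K 0)"
    using sums_Suc_iff[of "\<lambda>n. c n * w ^ n" "K w - K 0"] by (simp add: c_def)
  have geo: "(\<lambda>n. 2 * L * norm w ^ n) sums (2 * L * (1 / (1 - norm w)))"
    using w by (intro sums_mult geometric_sums) simp
  have "cmod (K w - K 0) \<le> 2 * L * (1 / (1 - norm w))"
  proof (rule norm_sums_le[OF s2 geo])
    fix n
    have "norm (c (Suc n) * w ^ Suc n) = cmod (c (Suc n)) * norm w ^ Suc n"
      by (simp only: norm_mult norm_power)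
    also have "\<dots> \<le> 2 * L * norm w ^ n"
      using w L0 c[of "Suc n"] by (intro mult_mono power_decreasing) auto
    finally show "norm (c (Suc n) * w ^ Suc n) \<le> 2 * L * norm w ^ n" .
  qed
  then show ?thesis using norm_triangle_sub[of "K w" "K 0"] by simp
qed

section \<open>Growth of the logarithm of the quotient\<close>

text \<open>Since \<open>\<bar>f g\<bar> \<le> M\<^sup>2 exp (-\<bar>Re k\<bar>)\<close>, the circle means of \<open>\<bar>Re k\<bar>\<close> are bounded.\<close>

lemma log_quotient_growth:
  assumes f: "f holomorphic_on right_half_plane" and g: "g holomorphic_on right_half_plane"
    and k: "k holomorphic_on right_half_plane"
    and fg: "\<And>z. Re z > 0 \<Longrightarrow> f z = exp (k z) * g z"
    and d: "d > 0" and M: "\<And>z. Re z \<ge> d \<Longrightarrow> cmod (f z) \<le> M" "\<And>z. Re z \<ge> d \<Longrightarrow> cmod (g z) \<le> M"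
    and nz: "f (Complex (1 + d) y0) \<noteq> 0" "g (Complex (1 + d) y0) \<noteq> 0"
  obtains A B where "A \<ge> 0" "B \<ge> 0"
    "\<And>z. Re z > d \<Longrightarrow> cmod (k z) \<le> A + B * (cmod (z - Complex d y0 + 1))\<^sup>2 / (Re z - d)"
proof -
  define \<phi> where "\<phi> = (\<lambda>w. Complex d y0 + (1 + w) / (1 - w))"
  have phi: "Re (\<phi> w) > d" if "norm w < 1" for w
    using Re_cayley_pos[OF that] by (simp add: \<phi>_def del: Re_divide)
  have phi0: "\<phi> 0 = Complex (1 + d) y0" by (simp add: \<phi>_def complex_eq_iff)
  have hol: "(\<lambda>w. u (\<phi> w)) holomorphic_on ball 0 1" if u: "u holomorphic_on right_half_plane" for u
  proof -
    have "(u \<circ> \<phi>) holomorphic_on ball 0 1"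
    proof (rule holomorphic_on_compose_gen[OF _ u])
      show "\<phi> holomorphic_on ball 0 1" unfolding \<phi>_def by (intro holomorphic_intros) auto
      show "\<phi> ` ball 0 1 \<subseteq> right_half_plane" using phi d by fastforce
    qed
    then show ?thesis by (simp add: o_def)
  qed
  define K where "K = (\<lambda>w. k (\<phi> w))"
  define F where "F = (\<lambda>w. f (\<phi> w) * g (\<phi> w))"
  have holK: "K holomorphic_on ball 0 1" unfolding K_def by (rule hol[OF k])
  have holF: "F holomorphic_on ball 0 1" unfolding F_def by (intro holomorphic_intros hol f g)
  have F0: "F 0 \<noteq> 0" using nz by (simp add: F_def phi0)
  have M0: "M > 0"
  proof -
    have "cmod (g (Complex (1 + d) y0)) \<le> M" by (rule M(2)) simp
    then show ?thesis using nz(2) by (metis less_le_trans zero_less_norm_iff)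
  qed
  \<comment> \<open>The larger of the two moduli is at most \<open>M\<close>, and the smaller one is
    \<open>exp (- \<bar>u\<bar>)\<close> times the larger.\<close>
  have Fle: "cmod (F w) \<le> exp (2 * ln M - \<bar>Re (K w)\<bar>)" if w: "norm w < 1" for w
  proof -
    define a b u where "a = cmod (f (\<phi> w))" and "b = cmod (g (\<phi> w))" and "u = Re (K w)"
    have ab: "a = exp u * b" using fg[of "\<phi> w"] phi[OF w] d by (simp add: a_def b_def u_def K_def norm_mult)
    have bounds: "0 \<le> a" "0 \<le> b" "a \<le> M" "b \<le> M"
      using M phi[OF w] by (auto simp: a_def b_def less_imp_le)
    have "a * b \<le> M * (M * exp (- \<bar>u\<bar>))"
    proof (cases "u \<ge> 0")
      case True
      then have "b = exp (- \<bar>u\<bar>) * a" by (simp add: ab exp_minus)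
      then have "b \<le> M * exp (- \<bar>u\<bar>)" using bounds by (simp add: mult.commute mult_left_mono)
      then show ?thesis using bounds by (intro mult_mono) auto
    next
      case False
      then have "a = exp (- \<bar>u\<bar>) * b" by (simp add: ab)
      then have "a \<le> M * exp (- \<bar>u\<bar>)" using bounds by (simp add: mult.commute mult_left_mono)
      then have "b * a \<le> M * (M * exp (- \<bar>u\<bar>))" using bounds M0 by (intro mult_mono) auto
      then show ?thesis by (simp add: mult.commute)
    qed
    also have "M * (M * exp (- \<bar>u\<bar>)) = exp (2 * ln M - \<bar>u\<bar>)"
    proof -
      have e2: "exp (2 * ln M) = M * M" using M0 by (simp add: exp_double power2_eq_square)
      show ?thesis unfolding exp_diff e2 exp_minus by (simp add: field_simps)
    qed
    finally show ?thesis by (simp add: F_def a_def b_def u_def norm_mult)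
  qed
  define L where "L = 2 * ln M - ln (cmod (F 0))"
  \<comment> \<open>The mean inequality for \<open>F\<close> with exponent
    \<open>2 * ln M - \<bar>Re (K w)\<bar>\<close>, solved for the mean of
    \<open>\<bar>Re K\<bar>\<close>.\<close>
  have mean: "integral {0..2*pi} (\<lambda>t. \<bar>Re (K (of_real r * cis t))\<bar>) \<le> 2 * pi * L" if r: "0 < r" "r < 1" for r
  proof -
    have sub: "cball 0 r \<subseteq> ball (0::complex) 1" using r by auto
    have contK: "continuous_on (cball 0 r) K"
      using holomorphic_on_imp_continuous_on[OF holK] sub continuous_on_subset by blast
    have ci: "(\<lambda>t. \<bar>Re (K (of_real r * cis t))\<bar>) integrable_on {0..2*pi}"
      using r by (intro integrable_continuous_interval continuous_intros continuous_on_compose2[OF contK])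
        (auto simp: norm_mult)
    have "norm (F 0) \<le> exp (integral {0..2*pi} (\<lambda>t. (\<lambda>w. 2 * ln M - \<bar>Re (K w)\<bar>) (of_real r * cis t)) / (2*pi))"
    proof (rule norm_center_le_exp_mean)
      show "F holomorphic_on ball 0 r" using holF sub ball_subset_cball holomorphic_on_subset by (metis order_trans)
      show "continuous_on (cball 0 r) F"
        using holomorphic_on_imp_continuous_on[OF holF] sub continuous_on_subset by blast
      show "continuous_on (sphere 0 r) (\<lambda>w. 2 * ln M - \<bar>Re (K w)\<bar>)"
        by (intro continuous_intros continuous_on_subset[OF contK]) auto
    qed (use r Fle in auto)
    also have "integral {0..2*pi} (\<lambda>t. (\<lambda>w. 2 * ln M - \<bar>Re (K w)\<bar>) (of_real r * cis t))
        = 2 * pi * (2 * ln M) - integral {0..2*pi} (\<lambda>t. \<bar>Re (K (of_real r * cis t))\<bar>)"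
      using ci by (subst integral_diff) auto
    finally have "ln (norm (F 0)) \<le> ln (exp ((2 * pi * (2 * ln M)
        - integral {0..2*pi} (\<lambda>t. \<bar>Re (K (of_real r * cis t))\<bar>)) / (2*pi)))"
      using F0 by (intro ln_mono) auto
    then show ?thesis by (simp add: L_def field_simps)
  qed
  have L0: "L \<ge> 0"
  proof -
    have "cmod (F 0) \<le> exp (2 * ln M)" by (rule order_trans[OF Fle]) auto
    then have "ln (cmod (F 0)) \<le> ln (exp (2 * ln M))" using F0 by (intro ln_mono) auto
    then show ?thesis by (simp add: L_def)
  qed
  have bound: "cmod (k z) \<le> cmod (K 0) + L * (cmod (z - Complex d y0 + 1))\<^sup>2 / (Re z - d)" if z: "Re z > d" for z
  proof -
    define \<zeta> where "\<zeta> = z - Complex d y0"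
    have re: "Re \<zeta> = Re z - d" "Re \<zeta> > 0" using z by (auto simp: \<zeta>_def)
    have ne: "\<zeta> + 1 \<noteq> 0" using re by (auto simp: complex_eq_iff)
    define w where "w = (\<zeta> - 1) / (\<zeta> + 1)"
    have w1: "norm w < 1" using norm_cayley_inverse_less_1[OF re(2), of 1] by (simp add: w_def)
    have "1 + w = 2 * \<zeta> / (\<zeta> + 1)" "1 - w = 2 / (\<zeta> + 1)" using ne by (auto simp: w_def field_simps)
    then have "(1 + w) / (1 - w) = \<zeta>" using ne by simp
    then have phiw: "\<phi> w = z" by (simp add: \<phi>_def \<zeta>_def)
    \<comment> \<open>This identity turns the disc bound in \<open>1 / (1 - norm w)\<close> into the
      half-plane bound in \<open>1 / Re \<zeta>\<close>.\<close>
    have "1 - (norm w)\<^sup>2 = ((cmod (\<zeta> + 1))\<^sup>2 - (cmod (\<zeta> - 1))\<^sup>2) / (cmod (\<zeta> + 1))\<^sup>2"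
    proof -
      have "(norm w)\<^sup>2 = (cmod (\<zeta> - 1))\<^sup>2 / (cmod (\<zeta> + 1))\<^sup>2"
        by (simp add: w_def norm_divide power_divide)
      then show ?thesis using ne by (simp add: diff_divide_distrib)
    qed
    also have "(cmod (\<zeta> + 1))\<^sup>2 - (cmod (\<zeta> - 1))\<^sup>2 = 4 * Re \<zeta>"
      unfolding cmod_power2 by (simp add: power2_eq_square algebra_simps)
    finally have w2: "1 - (norm w)\<^sup>2 = 4 * Re \<zeta> / (cmod (\<zeta> + 1))\<^sup>2" .
    have "1 - (norm w)\<^sup>2 = (1 - norm w) * (1 + norm w)" by (simp add: power2_eq_square algebra_simps)
    also have "\<dots> \<le> (1 - norm w) * 2" using w1 by (intro mult_left_mono) auto
    finally have "2 * Re \<zeta> / (cmod (\<zeta> + 1))\<^sup>2 \<le> 1 - norm w" using w2 by simp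
    then have "2 * L / (1 - norm w) \<le> 2 * L / (2 * Re \<zeta> / (cmod (\<zeta> + 1))\<^sup>2)"
      using re ne L0 w1 by (intro divide_left_mono mult_pos_pos divide_pos_pos) auto
    also have "\<dots> = L * (cmod (\<zeta> + 1))\<^sup>2 / Re \<zeta>" using re(2) by simp
    finally have "2 * L / (1 - norm w) \<le> L * (cmod (\<zeta> + 1))\<^sup>2 / Re \<zeta>" .
    moreover have "cmod (K w) \<le> cmod (K 0) + 2 * L / (1 - norm w)"
      by (rule norm_le_of_mean_Re_bounded[OF holK mean w1])
    ultimately show ?thesis unfolding K_def phiw by (simp add: re(1) \<zeta>_def[symmetric])
  qed
  show ?thesis by (rule that[of "cmod (K 0)" L]) (use bound L0 in auto)
qed

section \<open>From periodicity and growth to an affine logarithm\<close>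

lemma deriv_periodic:
  assumes q: "q holomorphic_on right_half_plane"
    and per: "\<And>s. Re s > 0 \<Longrightarrow> q (s + 2) = q s" and s: "Re s > 0"
  shows "deriv q (s + 2) = deriv q s"
proof -
  have "(q has_field_derivative deriv q (s + 2)) (at (s + 2))"
    using s by (intro holomorphic_derivI[OF q]) auto
  then have "((\<lambda>s. q (s + 2)) has_field_derivative deriv q (s + 2)) (at s)"
    by (simp add: DERIV_shift)
  then have "(q has_field_derivative deriv q (s + 2)) (at s)"
    by (rule has_field_derivative_transform_within_open[of _ _ _ right_half_plane]) (use s per in auto)
  then show ?thesis by (simp add: DERIV_imp_deriv)
qed

text \<open>On the disc of radius \<open>n\<close> about \<open>s + 2 * of_nat n\<close> the growth
  bound is of order \<open>n\<close>, so Cauchy's estimate for the second derivative is of order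
  \<open>1/n\<close>; by periodicity it bounds the value at \<open>s\<close>.\<close>

lemma periodic_growth_imp_deriv2_zero:
  assumes k: "k holomorphic_on right_half_plane"
    and per: "\<And>s. Re s > 0 \<Longrightarrow> deriv k (s + 2) = deriv k s"
    and d: "d > 0" and AB: "A \<ge> 0" "B \<ge> 0"
    and growth: "\<And>z. Re z > d \<Longrightarrow> cmod (k z) \<le> A + B * (cmod (z - p))\<^sup>2 / (Re z - d)"
    and s: "Re s > 0"
  shows "deriv (deriv k) s = 0"
proof -
  have holp: "deriv k holomorphic_on right_half_plane" by (intro holomorphic_deriv k) simp
  have per2: "deriv (deriv k) (s + 2 * of_nat n) = deriv (deriv k) s" for n :: nat
  proof (induction n)
    case (Suc n)
    have "s + 2 * of_nat (Suc n) = (s + 2 * of_nat n) + 2" by simp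
    then show ?case using deriv_periodic[OF holp per, of "s + 2 * of_nat n"] s Suc by (simp only:) simp
  qed simp
  define c where "c = cmod s + cmod p"
  \<comment> \<open>The condition \<open>n > 2 * d\<close> yields
    \<open>Re z - d \<ge> n / 2\<close> on the disc; the term \<open>3 * real n\<close> is the
    translation \<open>2 * n\<close> plus the radius.\<close>
  have bound: "cmod (deriv (deriv k) s) \<le> 2 * (A + B * (c + 3 * real n)\<^sup>2 / (real n / 2)) / (real n)\<^sup>2"
    if n: "real n > 2 * d" for n :: nat
  proof -
    let ?c = "s + 2 * of_nat n"
    have n0: "real n > 0" using n d by linarith
    have re: "Re z \<ge> real n" if "z \<in> cball ?c (real n)" for z
    proof -
      have "\<bar>Re (?c - z)\<bar> \<le> real n" using that abs_Re_le_cmod[of "?c - z"] by (auto simp: dist_norm)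
      then have "Re ?c - Re z \<le> real n" unfolding abs_le_iff by simp
      then show ?thesis using s by simp
    qed
    have sub: "cball ?c (real n) \<subseteq> right_half_plane" using re n0 by fastforce
    have "norm ((deriv ^^ 2) k ?c) \<le> fact 2 * (A + B * (c + 3 * real n)\<^sup>2 / (real n / 2)) / (real n) ^ 2"
    proof (rule Cauchy_inequality)
      show "k holomorphic_on ball ?c (real n)"
        using k sub ball_subset_cball holomorphic_on_subset by (metis order_trans)
      show "continuous_on (cball ?c (real n)) k"
        using holomorphic_on_imp_continuous_on[OF k] sub continuous_on_subset by blast
      fix z assume z: "norm (?c - z) = real n"
      then have rz: "Re z \<ge> real n" by (intro re) (simp add: dist_norm)
      have "z - p = s + 2 * of_nat n - (?c - z) - p" by simp
      also have "cmod \<dots> \<le> cmod s + 2 * real n + real n + cmod p"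
        using z norm_triangle_ineq4[of "s + 2 * of_nat n - (?c - z)" p]
          norm_triangle_ineq4[of "s + 2 * of_nat n" "?c - z"] norm_triangle_ineq[of s "2 * of_nat n"]
        by (simp add: norm_mult)
      finally have zp: "cmod (z - p) \<le> c + 3 * real n" by (simp add: c_def)
      have "cmod (k z) \<le> A + B * (cmod (z - p))\<^sup>2 / (Re z - d)" using rz n d by (intro growth) linarith
      also have "\<dots> \<le> A + B * (c + 3 * real n)\<^sup>2 / (real n / 2)"
        using AB zp rz n n0 by (intro add_left_mono frac_le mult_left_mono power_mono) auto
      finally show "norm (k z) \<le> A + B * (c + 3 * real n)\<^sup>2 / (real n / 2)" .
    qed (rule n0)
    then show ?thesis using per2[of n] by (simp add: numeral_2_eq_2)
  qed
  have "(\<lambda>n. 2 * (A + B * (c + 3 * real n)\<^sup>2 / (real n / 2)) / (real n)\<^sup>2) \<longlonglongrightarrow> 0"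
    by real_asymp
  moreover have "\<forall>\<^sub>F n in sequentially. real n > 2 * d" by real_asymp
  then have "\<forall>\<^sub>F n in sequentially. cmod (deriv (deriv k) s) \<le> 2 * (A + B * (c + 3 * real n)\<^sup>2 / (real n / 2)) / (real n)\<^sup>2"
    by eventually_elim (rule bound)
  ultimately have "cmod (deriv (deriv k) s) \<le> 0"
    by (rule tendsto_lowerbound) simp
  then show ?thesis by simp
qed

lemma countable_vertical_zeros:
  assumes "f holomorphic_on right_half_plane" "\<exists>w\<in>right_half_plane. f w \<noteq> 0" "c > 0"
  shows "countable {y. f (Complex c y) = 0}"
proof (rule ccontr)
  assume "uncountable {y. f (Complex c y) = 0}"
  then have "f z = 0" if "Re z > 0" for z
    using uncountable_vertical_zeros_imp_zero[OF assms(1,3) _ _ that] by blast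
  then show False using assms(2) by auto
qed

lemma uncountable_co_countable:
  assumes "countable (A :: real set)"
  shows "uncountable (- A)"
proof
  assume "countable (- A)"
  then have "countable (A \<union> - A)" using assms by (intro countable_Un)
  then show False using uncountable_UNIV_real by simp
qed

text \<open>Equal orders give a zero-free holomorphic quotient, which has a logarithm
  \<open>k\<close> on the convex half-plane; growth and periodicity of \<open>deriv k\<close> make
  \<open>k\<close> affine. The equation for \<open>\<alpha>\<close> records the period 2.\<close>

lemma affine_log_quotient:
  assumes f: "f \<in> hardy1_rhp" and g: "g \<in> hardy1_rhp"
    and fnz: "\<exists>w\<in>right_half_plane. f w \<noteq> 0" and gnz: "\<exists>w\<in>right_half_plane. g w \<noteq> 0"
    and per: "\<And>s. Re s > 0 \<Longrightarrow> f s * g (s + 2) = g s * f (s + 2)"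
  obtains \<alpha> \<beta> where "exp (2 * \<alpha>) = 1" "\<And>z. Re z > 0 \<Longrightarrow> f z = exp (\<alpha> * z + \<beta>) * g z"
proof -
  note holf = hardy1_holomorphic[OF f] and holg = hardy1_holomorphic[OF g]
  have bdd: "\<exists>M. \<forall>z. Re z \<ge> d \<longrightarrow> cmod (u z) \<le> M" if "u \<in> hardy1_rhp" "d > 0" for u d
    using hardy1_bounded[OF that] by blast
  have zeq: "zorder f a = zorder g a" if a: "a \<in> right_half_plane" for a
  proof (rule antisym)
    show "zorder g a \<le> zorder f a"
      by (rule zorder_le_of_quotient_periodic[OF holf holg fnz gnz bdd[OF g] per]) (use a in auto)
    show "zorder f a \<le> zorder g a"
      by (rule zorder_le_of_quotient_periodic[OF holg holf gnz fnz bdd[OF f] per[symmetric]]) (use a in auto)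
  qed
  obtain h where h: "h holomorphic_on right_half_plane" "\<And>z. z \<in> right_half_plane \<Longrightarrow> h z \<noteq> 0"
      "\<And>z. z \<in> right_half_plane \<Longrightarrow> f z = h z * g z"
    using holomorphic_quotient_of_zorder_eq[OF holf holg right_half_plane_open right_half_plane_connected fnz gnz zeq]
    by blast
  have 1: "1 \<in> right_half_plane" by simp
  obtain k where k: "k holomorphic_on right_half_plane" "\<And>z. z \<in> right_half_plane \<Longrightarrow> exp (k z) = h z"
    using holomorphic_logarithm_exists[OF right_half_plane_convex right_half_plane_open h(1,2) 1] by blast
  have fg: "f z = exp (k z) * g z" if "Re z > 0" for z using h(3)[of z] k(2)[of z] that by simp
  have expper: "exp (k (s + 2)) = exp (k s)" if s: "Re s > 0" for s
  proof -
    let ?E = "\<lambda>s. exp (k (s + 2)) - exp (k s)"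
    have "(k \<circ> (\<lambda>s. s + 2)) holomorphic_on right_half_plane"
      by (intro holomorphic_on_compose_gen[OF _ k(1)] holomorphic_intros) auto
    then have E: "?E holomorphic_on right_half_plane"
      by (intro holomorphic_intros k(1)) (simp add: o_def)
    \<comment> \<open>Zeros of \<open>g\<close> at both ends of the translation are avoided so that
      \<open>per\<close> can be divided by its factors.\<close>
    let ?Y = "{y. g (Complex 1 y) = 0} \<union> {y. g (Complex 3 y) = 0}"
    have Y: "uncountable (- ?Y)"
      by (intro uncountable_co_countable countable_Un countable_vertical_zeros holg gnz) auto
    have "?E s = 0"
    proof (rule uncountable_vertical_zeros_imp_zero[OF E _ Y _ s])
      fix y assume y: "y \<in> - ?Y"
      have "Complex 1 y + 2 = Complex 3 y" by (simp add: complex_eq_iff)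
      then show "?E (Complex 1 y) = 0"
        using per[of "Complex 1 y"] fg[of "Complex 1 y"] fg[of "Complex 3 y"] y by simp
    qed simp
    then show ?thesis by simp
  qed
  \<comment> \<open>Periodicity of \<open>exp k\<close> determines \<open>k (s + 2) - k s\<close>
    only modulo \<open>2 * pi * \<i>\<close>, so it is passed to the derivative.\<close>
  have derper: "deriv k (s + 2) = deriv k s" if s: "Re s > 0" for s
  proof -
    have dk: "deriv (\<lambda>s. exp (k s)) s = exp (k s) * deriv k s" if "Re s > 0" for s
      using holomorphic_derivI[OF k(1) right_half_plane_open, of s] that
      by (intro DERIV_imp_deriv) (auto intro!: derivative_eq_intros)
    have "deriv (\<lambda>s. exp (k s)) (s + 2) = deriv (\<lambda>s. exp (k s)) s"
      by (intro deriv_periodic holomorphic_intros k(1) expper s)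
    then show ?thesis using dk[of s] dk[of "s + 2"] s expper[OF s] by simp
  qed
  obtain Mf where Mf: "\<And>z. Re z \<ge> 1/2 \<Longrightarrow> cmod (f z) \<le> Mf" using hardy1_bounded[OF f, of "1/2"] by auto
  obtain Mg where Mg: "\<And>z. Re z \<ge> 1/2 \<Longrightarrow> cmod (g z) \<le> Mg" using hardy1_bounded[OF g, of "1/2"] by auto
  let ?Y = "{y. f (Complex (1 + 1/2) y) = 0} \<union> {y. g (Complex (1 + 1/2) y) = 0}"
  have "uncountable (- ?Y)"
    by (intro uncountable_co_countable countable_Un countable_vertical_zeros holf holg fnz gnz) auto
  \<comment> \<open>The centre for Jensen's inequality must avoid the zeros of \<open>f\<close> and
    \<open>g\<close>; it lies at distance 1 from the line \<open>Re z = 1/2\<close>.\<close>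
  then have "- ?Y \<noteq> {}" by (metis countable_empty)
  then obtain y0 where y0: "f (Complex (1 + 1/2) y0) \<noteq> 0" "g (Complex (1 + 1/2) y0) \<noteq> 0" by blast
  obtain A B where AB: "A \<ge> 0" "B \<ge> 0"
    "\<And>z. Re z > 1/2 \<Longrightarrow> cmod (k z) \<le> A + B * (cmod (z - Complex (1/2) y0 + 1))\<^sup>2 / (Re z - 1/2)"
    by (rule log_quotient_growth[OF holf holg k(1) fg, of "1/2" "max Mf Mg" y0])
       (use Mf Mg y0 in \<open>auto simp: le_max_iff_disj\<close>)
  have d2: "deriv (deriv k) s = 0" if "Re s > 0" for s
    by (rule periodic_growth_imp_deriv2_zero[OF k(1) derper _ AB(1,2) _ that, of "1/2" "Complex (1/2) y0 - 1"])
       (use AB(3) in \<open>auto simp: algebra_simps\<close>)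
  have holp: "deriv k holomorphic_on right_half_plane" by (intro holomorphic_deriv k(1)) simp
  have "\<exists>c. \<forall>s\<in>right_half_plane. deriv k s = c"
  proof (rule has_field_derivative_zero_constant[OF right_half_plane_convex])
    show "(deriv k has_field_derivative 0) (at s within right_half_plane)" if "s \<in> right_half_plane" for s
      using holomorphic_derivI[OF holp right_half_plane_open that] d2[of s] that
      by (simp add: has_field_derivative_at_within)
  qed
  then obtain \<alpha> where \<alpha>: "\<And>s. s \<in> right_half_plane \<Longrightarrow> deriv k s = \<alpha>" by blast
  have "((\<lambda>s. k s - \<alpha> * s) has_field_derivative 0) (at s within right_half_plane)"
    if "s \<in> right_half_plane" for s
  proof -
    have "(k has_field_derivative \<alpha>) (at s within right_half_plane)"
      using holomorphic_derivI[OF k(1) right_half_plane_open that] \<alpha>[OF that]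
      by (simp add: has_field_derivative_at_within)
    from DERIV_diff[OF this DERIV_cmult_Id[of \<alpha>]] show ?thesis by simp
  qed
  then obtain \<beta> where \<beta>: "\<And>s. s \<in> right_half_plane \<Longrightarrow> k s - \<alpha> * s = \<beta>"
    using has_field_derivative_zero_constant[OF right_half_plane_convex, of "\<lambda>s. k s - \<alpha> * s"] by blast
  have ks: "k s = \<alpha> * s + \<beta>" if "Re s > 0" for s using \<beta>[of s] that by (simp add: algebra_simps)
  have "exp (\<alpha> * 3 + \<beta>) = exp (\<alpha> * 1 + \<beta>)" using expper[of 1] ks[of 1] ks[of 3] by simp
  moreover have "\<alpha> * 3 + \<beta> = 2 * \<alpha> + (\<alpha> * 1 + \<beta>)" by (simp add: algebra_simps)
  ultimately have "exp (2 * \<alpha>) = 1" by (simp only: exp_add) simp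
  moreover have "f z = exp (\<alpha> * z + \<beta>) * g z" if "Re z > 0" for z
    using fg[OF that] ks[OF that] by simp
  ultimately show ?thesis using that by blast
qed

section \<open>Two reflections and determination of the constant\<close>

theorem theorem2p13:
  fixes f g :: "complex \<Rightarrow> complex"
  assumes "f \<in> hardy1_rhp" and "g \<in> hardy1_rhp"
    and "AE y in lborel. \<exists>a b. has_boundary_value f y a \<and> has_boundary_value g y b
                               \<and> cmod a = cmod b"
    and "\<forall>y::real. cmod (f (Complex 1 y)) = cmod (g (Complex 1 y))"
  shows "\<exists>c. cmod c = 1 \<and> (\<forall>z\<in>right_half_plane. f z = c * g z)"
\<comment> \<open>If the boundary values of \<open>g\<close> vanish almost everywhere, so do those
  of \<open>f\<close>, and both functions are zero.\<close>
proof (cases "AE y in lborel. has_boundary_value g y 0")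
  case True
  have uniq: "b = b'" if "has_boundary_value u y b" "has_boundary_value u y b'" for u y b b'
    using that unfolding has_boundary_value_def by (rule tendsto_unique[rotated]) simp
  have "AE y in lborel. has_boundary_value f y 0"
    using True assms(3) by eventually_elim (use uniq in fastforce)
  then have "f z = 0" "g z = 0" if "Re z > 0" for z
    using True that assms(1,2) hardy1_boundary_zero_imp_zero by blast+
  then show ?thesis by (intro exI[of _ 1]) auto
next
  case False
  note holf = hardy1_holomorphic[OF assms(1)] and holg = hardy1_holomorphic[OF assms(2)]
  have gnz: "\<exists>w\<in>right_half_plane. g w \<noteq> 0"
  proof (rule ccontr)
    assume *: "\<not> ?thesis"
    have "has_boundary_value g y 0" for y
    proof -
      have "\<forall>\<^sub>F x in at_right 0. g (Complex x y) = 0"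
        using * by (auto simp: eventually_at_right_field intro!: exI[of _ 1])
      then show ?thesis unfolding has_boundary_value_def by (rule tendsto_eventually)
    qed
    then show False using False by simp
  qed
  have fnz: "\<exists>w\<in>right_half_plane. f w \<noteq> 0"
  proof (rule ccontr)
    assume "\<not> ?thesis"
    then have "g (Complex 1 y) = 0" for y using assms(4) by (metis complex.sel(1) mem_right_half_plane norm_eq_zero zero_less_one)
    then have "g z = 0" if "Re z > 0" for z
      using uncountable_vertical_zeros_imp_zero[OF holg _ uncountable_UNIV_real _ that, of 1] by simp
    then show False using gnz by auto
  qed
  define S where "S = {y. \<exists>a b. has_boundary_value f y a \<and> has_boundary_value g y b \<and> cmod a = cmod b \<and> b \<noteq> 0}"
  \<comment> \<open>A countable \<open>S\<close> would be null, and \<open>g\<close> would have zero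
    boundary values almost everywhere.\<close>
  have S: "uncountable S"
  proof
    assume "countable S"
    then have "AE y in lborel. y \<notin> S" by (intro AE_not_in countable_imp_null_set_lborel)
    with assms(3) have "AE y in lborel. has_boundary_value g y 0"
      by eventually_elim (auto simp: S_def)
    then show False using False by simp
  qed
  \<comment> \<open>The limit of the reflection identity in \<open>Re s = 1\<close> as
    \<open>x\<close> tends to 0; \<open>b \<noteq> 0\<close> allows cancelling the boundary
    moduli.\<close>
  have line2: "cmod (f (Complex 2 y)) = cmod (g (Complex 2 y))" if y: "y \<in> S" for y
  proof -
    obtain a b where ab: "has_boundary_value f y a" "has_boundary_value g y b" "cmod a = cmod b" "b \<noteq> 0"
      using y by (auto simp: S_def)
    have lim: "((\<lambda>x. u (Complex x y) * cnj (u (Complex (2 - x) y))) \<longlongrightarrow> e * cnj (u (Complex 2 y))) (at_right 0)"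
      if u: "u holomorphic_on right_half_plane" "has_boundary_value u y e" for u e
    proof -
      have "isCont u (Complex (2 - 0) y)"
        using holomorphic_on_imp_continuous_on[OF u(1)] by (auto simp: continuous_on_eq_continuous_at)
      moreover have "((\<lambda>x. Complex (2 - x) y) \<longlongrightarrow> Complex (2 - 0) y) (at_right 0)"
        by (intro tendsto_Complex tendsto_intros)
      ultimately have "((\<lambda>x. u (Complex (2 - x) y)) \<longlongrightarrow> u (Complex (2 - 0) y)) (at_right 0)"
        by (rule isCont_tendsto_compose)
      then show ?thesis using u(2) unfolding has_boundary_value_def by (auto intro!: tendsto_intros)
    qed
    have "\<forall>\<^sub>F x in at_right 0. x \<in> {0<..<2::real}"
      by (intro eventually_at_right_real) simp
    then have "\<forall>\<^sub>F x in at_right 0. f (Complex x y) * cnj (f (Complex (2 - x) y))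
        = g (Complex x y) * cnj (g (Complex (2 - x) y))"
    proof eventually_elim
      case (elim x)
      have "2 * complex_of_real 1 - cnj (Complex x y) = Complex (2 - x) y" by (simp add: complex_eq_iff)
      then show ?case
        using reflection_identity[OF holf holg _ uncountable_UNIV_real, of 1 "Complex x y"] assms(4) elim by simp
    qed
    then have "((\<lambda>x. f (Complex x y) * cnj (f (Complex (2 - x) y))) \<longlongrightarrow> b * cnj (g (Complex 2 y))) (at_right 0)"
      using lim[OF holg ab(2)] by (simp add: filterlim_cong)
    then have "a * cnj (f (Complex 2 y)) = b * cnj (g (Complex 2 y))"
      using lim[OF holf ab(1)] tendsto_unique[OF trivial_limit_at_right_real] by blast
    then have "cmod a * cmod (f (Complex 2 y)) = cmod b * cmod (g (Complex 2 y))"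
      by (metis norm_mult complex_mod_cnj)
    then show ?thesis using ab(3,4) by simp
  qed
  have per: "f s * g (s + 2) = g s * f (s + 2)" if s: "Re s > 0" for s
  proof -
    let ?E = "\<lambda>s. f s * g (s + 2) - g s * f (s + 2)"
    have sh: "(\<lambda>s. u (s + 2)) holomorphic_on right_half_plane" if "u holomorphic_on right_half_plane" for u
    proof -
      have "(u \<circ> (\<lambda>s. s + 2)) holomorphic_on right_half_plane"
        by (intro holomorphic_on_compose_gen[OF _ that] holomorphic_intros) auto
      then show ?thesis by (simp add: o_def)
    qed
    have E: "?E holomorphic_on right_half_plane" by (intro holomorphic_intros sh holf holg)
    have Y: "uncountable (- {y. g (Complex 1 y) = 0})"
      by (intro uncountable_co_countable countable_vertical_zeros holg gnz) simp
    have "?E s = 0"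
    proof (rule uncountable_vertical_zeros_imp_zero[OF E _ Y _ s])
      fix y assume y: "y \<in> - {y. g (Complex 1 y) = 0}"
      define z where "z = Complex 1 y"
      have gz: "cnj (g z) \<noteq> 0" using y by (simp add: z_def)
      \<comment> \<open>\<open>R1\<close> comes from the line \<open>Re s = 1\<close>,
        \<open>R2\<close> from reflection in \<open>Re s = 2\<close>, which maps \<open>z\<close> to
        \<open>z + 2\<close>. Multiplying \<open>?E z\<close> by \<open>cnj (g z)\<close> makes the
        two cancel.\<close>
      have R1: "f z * cnj (f z) = g z * cnj (g z)"
        using assms(4) by (simp add: z_def complex_norm_square[symmetric])
      have "complex_of_real (2 * 2) - cnj z = z + 2" by (simp add: z_def complex_eq_iff)
      moreover have "f z * cnj (f (complex_of_real (2 * 2) - cnj z)) = g z * cnj (g (complex_of_real (2 * 2) - cnj z))"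
        by (rule reflection_identity[OF holf holg _ S line2]) (auto simp: z_def)
      ultimately have "f z * cnj (f (z + 2)) = g z * cnj (g (z + 2))" by (simp only:)
      then have R2: "cnj (f z) * f (z + 2) = cnj (g z) * g (z + 2)"
        by (metis complex_cnj_cnj complex_cnj_mult)
      have "cnj (g z) * ?E z = f z * (cnj (g z) * g (z + 2)) - (g z * cnj (g z)) * f (z + 2)"
        by (simp add: algebra_simps)
      also have "\<dots> = 0" unfolding R2[symmetric] R1[symmetric] by simp
      finally show "?E (Complex 1 y) = 0" using gz by (simp add: z_def)
    qed simp
    then show ?thesis by simp
  qed
  obtain \<alpha> \<beta> where \<alpha>: "exp (2 * \<alpha>) = 1" and fg: "\<And>z. Re z > 0 \<Longrightarrow> f z = exp (\<alpha> * z + \<beta>) * g z"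
    using affine_log_quotient[OF assms(1,2) fnz gnz per] by blast
  have Re\<alpha>: "Re \<alpha> = 0" using arg_cong[OF \<alpha>, of cmod] by simp
  \<comment> \<open>On \<open>Re s = 1\<close> the exponential has modulus 1, so the real part of
    its exponent vanishes. Two different heights then force \<open>Im \<alpha> = 0\<close>.\<close>
  have re: "Re \<beta> = Im \<alpha> * y" if "g (Complex 1 y) \<noteq> 0" for y
  proof -
    have "cmod (exp (\<alpha> * Complex 1 y + \<beta>)) * cmod (g (Complex 1 y)) = cmod (g (Complex 1 y))"
      using fg[of "Complex 1 y"] assms(4) by (metis complex.sel(1) norm_mult zero_less_one)
    then show ?thesis using that Re\<alpha> by simp
  qed
  have unc: "uncountable (- {y. g (Complex 1 y) = 0})"
    by (intro uncountable_co_countable countable_vertical_zeros holg gnz) simp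
  have inf: "infinite (- {y. g (Complex 1 y) = 0})" using unc countable_finite by blast
  obtain y1 where y1: "g (Complex 1 y1) \<noteq> 0" using inf by (metis (mono_tags) ComplD finite.emptyI ex_in_conv mem_Collect_eq)
  have "infinite (- {y. g (Complex 1 y) = 0} - {y1})" using inf by simp
  then have "- {y. g (Complex 1 y) = 0} - {y1} \<noteq> {}" by (metis finite.emptyI)
  then obtain y2 where y2: "g (Complex 1 y2) \<noteq> 0" "y2 \<noteq> y1" by blast
  have "Im \<alpha> * y1 = Im \<alpha> * y2" by (rule trans[OF sym[OF re[OF y1]] re[OF y2(1)]])
  then have "Im \<alpha> = 0" using y2(2) by (simp only: mult_cancel_left) simp
  then have "\<alpha> = 0" "Re \<beta> = 0" using Re\<alpha> re[OF y1] by (auto simp: complex_eq_iff)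
  then show ?thesis using fg by (intro exI[of _ "exp \<beta>"]) auto
qed

end
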